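(* Let $k\ge 2$ be an integer, and let $N$ be the maximum order (number of vertices) of a mixed Abelian Cayley graph of diameter $k$ with parameters $r_1=1$, $r_2=0$, $z=2$, i.e. of a Cayley graph $\mathrm{Cay}(\Gamma,\{\iota,b_1,b_2\})$ of a finite Abelian group $\Gamma$, where $\iota$ is an involution and $b_1,b_2$ are generators whose inverses do not belong to $\{\iota,b_1,b_2\}$. Then $N$ is as follows, and in each case the listed graphs $\mathrm{Cay}(\Gamma,\Sigma)$ have these parameters, diameter $k$ and order $N$ (below $x$ denotes an integer with $x>1$, and the first listed element of $\Sigma$ is the involution unless indicated otherwise): (1) $k=2$: $N=8$, attained by $\Gamma=\mathbb{Z}_8$, $\Sigma=\{1,3,4\}$ (involution $4$). (2) $k=3$: $N=12$, attained by $\Gamma=\mathbb{Z}_{12}$, $\Sigma=\{1,4,6\}$ (involution $6$). (3) $k=4$: $N=18$, attained by $\Gamma=\mathbb{Z}_{18}$, $\Sigma=\{1,4,9\}$ (involution $9$). (4) $k=3x-1$: $N=6x^2$, attained - for $x$ even, by $\Gamma=\mathbb{Z}_2\times\mathbb{Z}_x\times\mathbb{Z}_{3x}$, $\Sigma=\{(1,0,0),(1,1,1),(1,3,2)\}$; - for $x$ odd, by $\Gamma=\mathbb{Z}_x\times\mathbb{Z}_{6x}$, $\Sigma=\{(0,3x),(1,-2),(3-x,3x-7)\}$; - for every $x$, by $\Gamma=\mathbb{Z}_x\times\mathbb{Z}_{6x}$, $\Sigma=\{(0,3x),(3,2),(1,1)\}$. (5) $k=3x$: $N=6x^2+4x$,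 attained - for $x$ even, by $\Gamma=\mathbb{Z}_2\times\mathbb{Z}_{N/2}$, $\Sigma=\{(1,0),(1,1),(-3x,-3x)\}$; - for $x$ odd, by $\Gamma=\mathbb{Z}_N$, $\Sigma=\{N/2,\,N/2+1,\,3x^2-x\}$; - for every $x$, by $\Gamma=\mathbb{Z}_N$, $\Sigma=\{N/2,\,2x+1,\,x\}$. (6) $k=3x+1$: $N=6x^2+8x+2$, attained - for $x$ even, by $\Gamma=\mathbb{Z}_N$ with $\Sigma=\{N/2,\,N/2+1,\,6x^2+5x\}$, and also by $\Gamma=\mathbb{Z}_N$ with $\Sigma=\{N/2,\,N/2-3x-2,\,N/2+1\}$; - for $x$ odd, by $\Gamma=\mathbb{Z}_2\times\mathbb{Z}_{N/2}$ with $\Sigma=\{(1,0),(1,1),(-3x-2,-3x-2)\}$, and also by $\Gamma=\mathbb{Z}_N$ with $\Sigma=\{N/2,\,N/2-3x-2,\,1\}$.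
   Context: For a finite Abelian group $\Gamma$ (written additively) and a generating set $\Sigma\subseteq\Gamma\setminus\{0\}$, the Cayley graph $\mathrm{Cay}(\Gamma,\Sigma)$ has vertex set $\Gamma$, with each vertex $u$ adjacent to the vertices $u+a$, $a\in\Sigma$. If $\Sigma$ consists of $r_1$ involutions (elements of order $2$), $r_2$ pairs $\{a,-a\}$ with $a\ne -a$, and $z$ further generators $b$ with $-b\notin\Sigma$, then $\mathrm{Cay}(\Gamma,\Sigma)$ is viewed as a mixed graph: involutions and pairs $\pm a$ give undirected edges (undirected degree $r=r_1+2r_2$), and the other generators give arcs (directed out-degree $z$). It is called a mixed Abelian Cayley graph with parameters $r_1,r_2,z$. Distance from $u$ to $v$ is the length of a shortest path from $u$ to $v$, where arcs are traversed only in their direction and edges in either direction; the diameter is the maximum distance over all ordered pairs of vertices. $\mathbb{Z}_n$ denotes the cyclic group of integers modulo $n$, and entries of the generators are read modulo the corresponding moduli. *)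

theory Defs
  imports "HOL-Algebra.Algebra" "Graph_Theory.Graph_Theory"
begin

(* A mixed graph is represented as a digraph in which an undirected edge is a pair of opposite
   arcs.  This is what an involution or a pair of mutually inverse generators produces here, and
   a directed walk then crosses edges both ways and arcs only forwards. *)

definition cayley_graph :: "('a, 'm) monoid_scheme \<Rightarrow> 'a set \<Rightarrow> 'a pair_pre_digraph" where
  "cayley_graph G S =
     \<lparr> pverts = carrier G,
       parcs = {(u, u \<otimes>\<^bsub>G\<^esub> a) | u a. u \<in> carrier G \<and> a \<in> S} \<rparr>"

(* With unit weights, the library's minimal walk cost is the usual distance; it is infinite if
   there is no directed walk. *)

definition digraph_dist :: "('v, 'e) pre_digraph \<Rightarrow> 'v \<Rightarrow> 'v \<Rightarrow> ereal" where
  "digraph_dist D u v = wf_digraph.\<mu> D (\<lambda>_. 1) u v"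

definition digraph_diameter :: "('v, 'e) pre_digraph \<Rightarrow> ereal" where
  "digraph_diameter D = (SUP u\<in>verts D. SUP v\<in>verts D. digraph_dist D u v)"

definition mixed_abelian_cayley ::
  "('a, 'm) monoid_scheme \<Rightarrow> 'a set \<Rightarrow> nat \<Rightarrow> nat \<Rightarrow> nat \<Rightarrow> bool" where
  "mixed_abelian_cayley G S r1 r2 z \<longleftrightarrow>
     comm_group G \<and> finite (carrier G) \<and>
     S \<subseteq> carrier G - {\<one>\<^bsub>G\<^esub>} \<and> generate G S = carrier G \<and>
     card {a \<in> S. group.ord G a = 2} = r1 \<and>
     card {a \<in> S. inv\<^bsub>G\<^esub> a \<in> S \<and> inv\<^bsub>G\<^esub> a \<noteq> a} = 2 * r2 \<and>
     card {b \<in> S. inv\<^bsub>G\<^esub> b \<notin> S} = z"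

definition mixed_abelian_cayley_diam ::
  "('a, 'm) monoid_scheme \<Rightarrow> 'a set \<Rightarrow> nat \<Rightarrow> nat \<Rightarrow> nat \<Rightarrow> nat \<Rightarrow> bool" where
  "mixed_abelian_cayley_diam G S r1 r2 z k \<longleftrightarrow>
     mixed_abelian_cayley G S r1 r2 z \<and>
     digraph_diameter (with_proj (cayley_graph G S)) = ereal (real k)"

definition attains ::
  "('a, 'm) monoid_scheme \<Rightarrow> 'a \<Rightarrow> 'a \<Rightarrow> 'a \<Rightarrow> nat \<Rightarrow> nat \<Rightarrow> bool" where
  "attains G i b1 b2 k N \<longleftrightarrow>
     mixed_abelian_cayley_diam G {i, b1, b2} 1 0 2 k \<and> group.ord G i = 2 \<and> order G = N"

abbreviation Zmod :: "nat \<Rightarrow> int monoid" where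
  "Zmod \<equiv> integer_mod_group"

(* The carrier of Zmod n is {0..<n} (for n > 0), so generator entries have to be reduced. *)

abbreviation res1 :: "nat \<Rightarrow> int \<Rightarrow> int" where
  "res1 n a \<equiv> a mod int n"

abbreviation res2 :: "nat \<Rightarrow> nat \<Rightarrow> int \<Rightarrow> int \<Rightarrow> int \<times> int" where
  "res2 m n a b \<equiv> (a mod int m, b mod int n)"

abbreviation res3 :: "nat \<Rightarrow> nat \<Rightarrow> nat \<Rightarrow> int \<Rightarrow> int \<Rightarrow> int \<Rightarrow> int \<times> int \<times> int" where
  "res3 l m n a b c \<equiv> (a mod int l, b mod int m, c mod int n)"

end

theory Submission
  imports Defs
begin

text \<open>Write the group additively and let \<open>Q\<close> be its quotient by the involution \<open>\<iota>\<close>, of order \<open>N / 2\<close>.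
  If \<open>b\<^sub>1, b\<^sub>2\<close> reach all of \<open>Q\<close> within \<open>k - 1\<close> steps, then \<open>Q\<close> has an L-shaped system of
  representatives \<open>(m, n)\<close> with \<open>m + n \<le> k - 1\<close>, and such a shape has at most \<open>(k + 1)\<^sup>2 / 3\<close> points.
  Otherwise some class of \<open>Q\<close> needs \<open>k\<close> steps; both of its elements are then words of length \<open>k\<close> in
  \<open>b\<^sub>1, b\<^sub>2\<close>, and their difference shows that \<open>\<iota>\<close> is a multiple \<open>t \<delta>\<close> of \<open>\<delta> = b\<^sub>1 - b\<^sub>2\<close> with
  \<open>0 < t \<le> k\<close>. The cosets of the subgroup generated by \<open>\<delta>\<close> are cycles, words of equal length occupy
  arcs of them, and covering all the cycles by arcs forces \<open>N \<le> 2 (k + 1)\<^sup>2 / 3\<close> or \<open>N \<le> (k + 2)\<^sup>2 / 2\<close>.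

  Conversely, in every family listed the generators satisfy, modulo \<open>\<iota>\<close>, the relations of an optimal
  L-shape with words of length at most \<open>k - 1\<close>, so the diameter is at most \<open>k\<close>. It is not smaller, since
  \<open>N\<close> exceeds the bound for \<open>k - 1\<close>; likewise a degenerate set of generators (such as \<open>b\<^sub>1 = - b\<^sub>2\<close>)
  would make the group too small.\<close>

section \<open>Covering cycles by arcs\<close>

text \<open>A group element \<open>s b\<^sub>2 + p \<delta>\<close> (notation of the header, \<open>m b\<^sub>2 = a \<delta>\<close>, \<open>n \<delta> = \<iota>\<close>) is reached exactly
  by the words with \<open>s + c m\<close> generators \<open>b\<^sub>1, b\<^sub>2\<close>, of which \<open>i\<close> are \<open>b\<^sub>1\<close>, and \<open>e\<close> copies of \<open>\<iota>\<close>: in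
  each class \<open>s\<close>, arcs of \<open>s + c m + 1\<close> consecutive residues \<open>p\<close> modulo \<open>2 n\<close> have to cover all of them.\<close>

lemma arc_cover_bound:
  fixes m n a k :: int
  assumes m: "m \<ge> 1" and n: "n \<ge> 1" "n \<le> k"
    and cover: "\<And>s p. \<lbrakk>0 \<le> s; s < m\<rbrakk> \<Longrightarrow>
      \<exists>c i e. 0 \<le> c \<and> 0 \<le> i \<and> i \<le> s + c * m \<and> 0 \<le> e \<and> e \<le> 1 \<and> s + c * m + e \<le> k \<and>
        2 * n dvd p - c * a - i - e * n"
  shows "3 * (n * m) \<le> (k + 1)\<^sup>2 \<or> 4 * (n * m) \<le> (k + 2)\<^sup>2"
proof -
  have dvdn: "n dvd p - c * a - i" if "2 * n dvd p - c * a - i - e * n" for p c i e :: int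
  proof -
    have "n dvd p - c * a - i - e * n" using that by (rule dvd_mult_right)
    then have "n dvd p - c * a - i - e * n + e * n" by (intro dvd_add) auto
    then show ?thesis by simp
  qed
  have le: "n \<le> y" if "n dvd y" "0 < y" for y using that by (rule zdvd_imp_le)
  have le': "n \<le> - y" if "n dvd y" "y < 0" for y using le[of "- y"] that by simp
  have cm: "c < j" if "c * m < j * m" for c j using mult_right_mono[of j c m] m that by linarith
  \<comment> \<open>If \<open>3 * m - 1 \<le> k\<close>, the bound follows from
    \<open>n \<le> k\<close>. Otherwise the class with the fewest arcs decides: it has none, one
    (class \<open>k - m + 1\<close>, which is 0 for \<open>k = m - 1\<close>) or two.\<close>
  consider "3 * m - 1 \<le> k" | "k < m - 1" | "k = m - 1" | "m \<le> k" "k \<le> 2 * m - 2"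
    | "2 * m - 1 \<le> k" "k \<le> 3 * m - 2" by linarith
  then show ?thesis
  proof cases
    case 1
    have "n * (3 * m) \<le> k * (k + 1)" using 1 m n by (intro mult_mono) auto
    also have "\<dots> \<le> (k + 1)\<^sup>2" using n by (auto simp: power2_eq_square algebra_simps)
    finally show ?thesis by simp
  next
    case 2
    obtain c where "0 \<le> c" "k + 1 + c * m \<le> k" using cover[of "k + 1" 0] 2 n by force
    then show ?thesis using cm[of c 0] by linarith
  next
    case 3
    from cover[of 0 1] m obtain c i e where *: "0 \<le> c" "0 \<le> i" "i \<le> c * m" "0 \<le> e"
      "c * m + e \<le> k" "2 * n dvd 1 - c * a - i - e * n" by auto
    have "c = 0" using cm[of c 1] * 3 by linarith
    with * dvdn[OF *(6)] have "n dvd 1" by auto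
    then have "n = 1" using n by simp
    then have "4 * (n * m) = 4 * k + 4" using 3 by simp
    then have "4 * (n * m) \<le> (k + 2)\<^sup>2"
      using zero_le_power2[of k] by (simp add: power2_eq_square algebra_simps)
    then show ?thesis ..
  next
    case 4
    \<comment> \<open>A second arc of this class would need words of length \<open>k + 1\<close>.
      The residue just after the only arc \<open>[0, ?s]\<close> is therefore reached only after a
      full turn modulo \<open>n\<close>.\<close>
    let ?s = "k - m + 1"
    from cover[of ?s "?s + 1"] 4 obtain c i e where *: "0 \<le> c" "0 \<le> i" "i \<le> ?s + c * m" "0 \<le> e"
      "?s + c * m + e \<le> k" "2 * n dvd ?s + 1 - c * a - i - e * n" by auto
    have c: "c = 0" using cm[of c 1] * by linarith
    have "n dvd ?s + 1 - i" using dvdn[OF *(6)] c by simp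
    moreover have "0 < ?s + 1 - i" using * c by simp
    ultimately have "n \<le> k - m + 2" using * le by force
    then have "n * m \<le> (k - m + 2) * m" using m by (intro mult_right_mono) auto
    moreover have "4 * ((k - m + 2) * m) + (k + 2 - 2 * m)\<^sup>2 = (k + 2)\<^sup>2"
      by (simp add: power2_eq_square algebra_simps)
    ultimately have "4 * (n * m) \<le> (k + 2)\<^sup>2" using zero_le_power2[of "k + 2 - 2 * m"] by linarith
    then show ?thesis ..
  next
    case 5
    \<comment> \<open>The class \<open>r + 1\<close> is covered modulo \<open>n\<close> by two arcs with at most one overlap, which determines
      \<open>a\<close> up to two values; then the class \<open>r\<close> (the class \<open>m - 1\<close>, shifted, if \<open>r = -1\<close>) misses a residue
      modulo \<open>n\<close> except for the single longest arc, which is too short to meet both of its lifts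
      modulo \<open>2 n\<close>.\<close>
    define r where "r = k - 2 * m"
    have r: "-1 \<le> r" "r \<le> m - 2" "k = 2 * m + r" using 5 by (auto simp: r_def)
    have upper: False if big: "n \<ge> 2 * r + m + 3" "n \<ge> r + m + 3"
    proof -
      have arcs: "\<exists>i. 0 \<le> i \<and> (i \<le> r + 1 \<and> n dvd p - i \<or> i \<le> r + 1 + m \<and> n dvd p - a - i)" for p
      proof -
        from cover[of "r + 1" p] r obtain c i e where *: "0 \<le> c" "0 \<le> i" "i \<le> r + 1 + c * m" "0 \<le> e"
          "r + 1 + c * m + e \<le> k" "2 * n dvd p - c * a - i - e * n" by auto
        have "c = 0 \<or> c = 1" using cm[of c 2] * r m by linarith
        then show ?thesis using * dvdn[OF *(6)] by (intro exI[of _ i]) auto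
      qed
      have arcs': "\<exists>i. 0 \<le> i \<and> (i \<le> r \<and> n dvd p - i \<or> i \<le> r + m \<and> n dvd p - a - i \<or>
          i \<le> k \<and> 2 * n dvd p - 2 * a - i)" for p
      proof (cases "r \<ge> 0")
        case True
        from cover[of r p] r True obtain c i e where *: "0 \<le> c" "0 \<le> i" "i \<le> r + c * m" "0 \<le> e"
          "r + c * m + e \<le> k" "2 * n dvd p - c * a - i - e * n" by auto
        have "c < 3" using cm[of c 3] * r m by linarith
        then have "c = 0 \<or> c = 1 \<or> c = 2" using * by linarith
        moreover have "c = 2 \<Longrightarrow> e = 0" using * r by auto
        ultimately consider "c = 0" | "c = 1" | "c = 2" "e = 0" by blast
        then show ?thesis using * dvdn[OF *(6)] by cases (intro exI[of _ i]; auto)+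
      next
        case False
        then have r': "r = -1" using r by simp
        from cover[of "m - 1" "p - a"] m obtain c i e where *: "0 \<le> c" "0 \<le> i"
          "i \<le> m - 1 + c * m" "0 \<le> e"
          "m - 1 + c * m + e \<le> k" "2 * n dvd p - a - c * a - i - e * n" by auto
        have "c < 2" using cm[of c 2] * r r' m by linarith
        then have "c = 0 \<or> c = 1" using * by linarith
        moreover have "c = 1 \<Longrightarrow> e = 0" using * r r' by auto
        ultimately consider "c = 0" | "c = 1" "e = 0" by blast
        then show ?thesis
          using * dvdn[OF *(6)] r r' by cases (intro exI[of _ i]; auto simp: algebra_simps)+
      qed
      obtain j where j: "0 \<le> j" "j \<le> r + 1 + m" "n dvd r + 2 - a - j"
      proof -
        from arcs[of "r + 2"] obtain i where i: "0 \<le> i"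
          "i \<le> r + 1 \<and> n dvd r + 2 - i \<or> i \<le> r + 1 + m \<and> n dvd r + 2 - a - i" by blast
        have "\<not> (i \<le> r + 1 \<and> n dvd r + 2 - i)"
        proof
          assume *: "i \<le> r + 1 \<and> n dvd r + 2 - i"
          then have "n \<le> r + 2 - i" by (intro le) auto
          then show False using big r i by linarith
        qed
        then show ?thesis using i that by blast
      qed
      \<comment> \<open>\<open>b\<close> is the lift of \<open>a\<close> modulo \<open>n\<close> for
        which the second arc contains the integer \<open>r + 2\<close>, just past the first
        arc.\<close>
      define b where "b = r + 2 - j"
      have ab: "n dvd b - a" using j by (simp add: b_def algebra_simps)
      have shift: "n dvd p - b - i \<longleftrightarrow> n dvd p - a - i" for p i
        using dvd_add_right_iff[OF ab, of "p - b - i"] by (simp add: algebra_simps)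
      obtain i where i: "0 \<le> i" "i \<le> r + 1 + m" "n dvd - 1 - b - i"
      proof -
        from arcs[of "- 1"] obtain i where i: "0 \<le> i"
          "i \<le> r + 1 \<and> n dvd - 1 - i \<or> i \<le> r + 1 + m \<and> n dvd - 1 - a - i" by blast
        have "\<not> (i \<le> r + 1 \<and> n dvd - 1 - i)"
        proof
          assume *: "i \<le> r + 1 \<and> n dvd - 1 - i"
          then have "n \<le> - (- 1 - i)" using i by (intro le') auto
          then show False using * big m by linarith
        qed
        then show ?thesis using i that shift by blast
      qed
      \<comment> \<open>Otherwise the second arc contains both \<open>- 1\<close> and
        \<open>r + 2\<close> without wrapping, hence the whole first arc, and \<open>b - 1\<close>
        lies in neither.\<close>
      have "- 1 - b - i \<noteq> 0"
      proof
        assume eq: "- 1 - b - i = 0"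
        from arcs[of "b - 1"] obtain h where h: "0 \<le> h"
          "h \<le> r + 1 \<and> n dvd b - 1 - h \<or> h \<le> r + 1 + m \<and> n dvd b - 1 - b - h"
          unfolding shift by blast
        from h(2) show False
        proof
          assume *: "h \<le> r + 1 \<and> n dvd b - 1 - h"
          then have "n \<le> - (b - 1 - h)" using eq h i by (intro le') auto
          then show False using * eq big i j unfolding b_def by linarith
        next
          assume *: "h \<le> r + 1 + m \<and> n dvd b - 1 - b - h"
          then have "n \<le> - (b - 1 - b - h)" using h by (intro le') auto
          then show False using * big m r by linarith
        qed
      qed
      moreover have "\<not> 0 < - 1 - b - i" using le[OF i(3)] big r j i b_def by linarith
      ultimately have nb: "n \<le> 1 + b + i" using le'[OF i(3)] by linarith
      \<comment> \<open>The second arc has to extend from \<open>b\<close> to \<open>n - 1\<close>;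
        it is too short for this if \<open>b \<le> r\<close>.\<close>
      have b2: "b = r + 2 \<or> b = r + 1" using nb big r i j b_def by linarith
      \<comment> \<open>\<open>z\<close> is a residue missed by the two shorter arcs of class
        \<open>r\<close>: just after the first one, or just before it.\<close>
      define z where "z = (if b = r + 2 then r + 1 else - 1)"
      have far: "\<exists>i. 0 \<le> i \<and> i \<le> k \<and> 2 * n dvd y - 2 * a - i" if y: "n dvd y - z" for y
      proof -
        from arcs'[of y] obtain i where i': "0 \<le> i" "i \<le> r \<and> n dvd y - i \<or>
          i \<le> r + m \<and> n dvd y - a - i \<or> i \<le> k \<and> 2 * n dvd y - 2 * a - i" by blast
        have yz: "n dvd y - t \<longleftrightarrow> n dvd z - t" for t
          using dvd_add_right_iff[OF y, of "z - t"] by simp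
        have "\<not> (i \<le> r \<and> n dvd y - i)"
        proof
          assume "i \<le> r \<and> n dvd y - i"
          then have "i \<le> r" "n dvd z - i" using yz by auto
          then show False using le[of "z - i"] le'[of "z - i"] big r i' b2 z_def
            by (auto split: if_splits)
        qed
        moreover have "\<not> (i \<le> r + m \<and> n dvd y - a - i)"
        proof
          assume "i \<le> r + m \<and> n dvd y - a - i"
          then have "i \<le> r + m" "n dvd z - b - i"
            using yz[of "a + i"] shift[of z i] by (auto simp: algebra_simps)
          then show False using le'[of "z - b - i"] big r i' b2 nb i z_def
            by (auto split: if_splits)
        qed
        ultimately show ?thesis using i' by blast
      qed
      obtain i1 where i1: "0 \<le> i1" "i1 \<le> k" "2 * n dvd z - 2 * a - i1" using far[of z] by auto
      obtain i2 where i2: "0 \<le> i2" "i2 \<le> k" "2 * n dvd z + n - 2 * a - i2" using far[of "z + n"] by auto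
      have "n dvd z - 2 * a - i1" using i1(3) by (rule dvd_mult_right)
      moreover have "n dvd z + n - 2 * a - i2" using i2(3) by (rule dvd_mult_right)
      then have "n dvd (z + n - 2 * a - i2) - n" by (rule dvd_diff) simp
      then have "n dvd z - 2 * a - i2" by (simp add: algebra_simps)
      ultimately have
        "n dvd z - 2 * a - min i1 i2" by (simp add: min_def)
      moreover have "n dvd 2 * (b - a)" using ab by (rule dvd_mult)
      ultimately have "n dvd (z - 2 * a - min i1 i2) - 2 * (b - a)" by (rule dvd_diff)
      then have d: "n dvd z - 2 * b - min i1 i2" by (simp add: algebra_simps)
      have "2 * n dvd (z + n - 2 * a - i2) - (z - 2 * a - i1)" using i2(3) i1(3) by (rule dvd_diff)
      then have d2: "2 * n dvd n + i1 - i2" by (simp add: algebra_simps)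
      \<comment> \<open>Both lifts of \<open>z\<close> lie on the arc of \<open>k + 1\<close>
        residues starting at \<open>2 * a\<close>, at distance at least \<open>n\<close>. The
        earlier one is then closer to the start than \<open>n dvd z - 2 * b - min i1 i2\<close>
        permits.\<close>
      have "n \<le> \<bar>i1 - i2\<bar>"
      proof (rule ccontr)
        assume "\<not> n \<le> \<bar>i1 - i2\<bar>"
        then show False using zdvd_imp_le[OF d2] by linarith
      qed
      then have "min i1 i2 \<le> k - n" using i1 i2 by linarith
      then show False using le'[OF d] big r b2 nb i i1 i2 z_def by (auto split: if_splits)
    qed
    have upper': "n < 2 * r + m + 3 \<or> n < r + m + 3" using upper by force
    show ?thesis
    proof (cases "r \<ge> 0")
      case True
      then have "n \<le> 2 * k - 3 * m + 2" using upper' r by linarith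
      then have "n * m \<le> (2 * k - 3 * m + 2) * m" using m by (intro mult_right_mono) auto
      \<comment> \<open>Completing the square: as a function of \<open>m\<close> the product peaks
        at \<open>3 * m = k + 1\<close>.\<close>
      moreover have "3 * ((2 * k - 3 * m + 2) * m) + (k + 1 - 3 * m)\<^sup>2 = (k + 1)\<^sup>2"
        by (simp add: power2_eq_square algebra_simps)
      ultimately have "3 * (n * m) \<le> (k + 1)\<^sup>2"
        using zero_le_power2[of "k + 1 - 3 * m"] by linarith
      then show ?thesis ..
    next
      case False
      then have "n \<le> m + 1" and k: "k = 2 * m - 1" using upper' r by linarith+
      then have "n * m \<le> (m + 1) * m" using m by (intro mult_right_mono) auto
      then have "4 * (n * m) \<le> (k + 2)\<^sup>2" unfolding k by (simp add: power2_eq_square algebra_simps)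
      then show ?thesis ..
    qed
  qed
qed

section \<open>Lattices covering the plane with triangles\<close>

text \<open>Raising \<open>l\<close> to \<open>E - y\<close> and \<open>h\<close> to
  \<open>E - x\<close> leaves \<open>E (x + y) - x\<^sup>2 - x y - y\<^sup>2\<close>, which is
  largest at \<open>x = y = E / 3\<close>.\<close>

lemma L_shape_area_bound:
  fixes l h x y E :: int
  assumes "0 \<le> x" "0 \<le> y" "l + y \<le> E" "x + h \<le> E"
  shows "3 * (l * y + x * (h - y)) \<le> E\<^sup>2"
proof -
  have "l * y \<le> (E - y) * y" "x * h \<le> x * (E - x)"
    using assms by (auto intro!: mult_right_mono mult_left_mono)
  then have "l * y + x * (h - y) \<le> (E - y) * y + x * (E - x) - x * y"
    by (simp add: right_diff_distrib)
  also have "3 * \<dots> \<le> E\<^sup>2"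
    using zero_le_power2[of "2 * E - 3 * (x + y)"] zero_le_power2[of "x - y"]
    by (simp add: power2_eq_square algebra_simps)
  finally show ?thesis by simp
qed

lemma least_int_counterexample:
  fixes P :: "int \<Rightarrow> bool"
  assumes "P 0" "\<not> P j" "0 \<le> j"
  obtains l where "\<not> P l" "\<forall>p. 0 \<le> p \<and> p < l \<longrightarrow> P p" "1 \<le> l"
proof -
  define n where "n = (LEAST i. \<not> P (int i))"
  have "\<not> P (int (nat j))" using assms by simp
  then have n: "\<not> P (int n)" unfolding n_def by (rule LeastI)
  moreover have "P p" if "0 \<le> p" "p < int n" for p
    using not_less_Least[of "nat p" "\<lambda>i. \<not> P (int i)"] that unfolding n_def by auto
  moreover have "n \<noteq> 0" using n assms(1) by (metis of_nat_0)
  ultimately show ?thesis using that[of "int n"] by simp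
qed

text \<open>The smallest representatives of the classes form an order ideal of the quadrant. Each inner corner
  of its boundary lies in the lattice \<open>K\<close>, and two of them would identify two points on the axes;
  hence there is at most one, and the ideal is L-shaped.\<close>

lemma triangle_cover_bound:
  fixes K :: "int \<Rightarrow> int \<Rightarrow> bool" and D :: int
  assumes zero: "K 0 0"
    and diff: "\<And>u v u' v'. K u v \<Longrightarrow> K u' v' \<Longrightarrow> K (u - u') (v - v')"
    and cover: "\<And>u v. \<exists>m n. 0 \<le> m \<and> 0 \<le> n \<and> m + n \<le> D \<and> K (u - m) (v - n)"
  obtains T where "finite T" "3 * int (card T) \<le> (D + 2)\<^sup>2"
    "\<forall>u v. \<exists>(m, n)\<in>T. K (u - m) (v - n)"
proof -
  have add: "K (u + u') (v + v')" if "K u v" "K u' v'" for u v u' v'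
    using diff[OF that(1) diff[OF zero that(2)]] by simp
  have neg: "K (- u) (- v)" if "K u v" for u v using diff[OF zero that] by simp
  \<comment> \<open>Comparing degrees first keeps the minimal representatives within degree
    \<open>D\<close>; translation invariance makes them an order ideal.\<close>
  define less :: "int \<Rightarrow> int \<Rightarrow> int \<Rightarrow> int \<Rightarrow> bool" where
    "less m' n' m n \<longleftrightarrow> m' + n' < m + n \<or> m' + n' = m + n \<and> m' < m" for m' n' m n
  define A where "A m n \<longleftrightarrow> 0 \<le> m \<and> 0 \<le> n \<and>
    (\<forall>m' n'. 0 \<le> m' \<and> 0 \<le> n' \<and> K (m - m') (n - n') \<longrightarrow> \<not> less m' n' m n)" for m n
  have A_nonneg: "0 \<le> m" "0 \<le> n" if "A m n" for m n using that by (auto simp: A_def)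
  have rep0: "\<exists>m n. A m n \<and> K (u - m) (v - n)" if "0 \<le> u" "0 \<le> v" for u v
    using that
  proof (induction "(u, v)" arbitrary: u v
      rule: wf_induct_rule[OF wf_measures[of "[\<lambda>(u, v). nat (u + v), \<lambda>(u, v). nat u]"]])
    case (1 u v)
    show ?case
    proof (cases "A u v")
      case True
      then show ?thesis using zero by (intro exI[of _ u] exI[of _ v]) simp
    next
      case False
      then obtain m' n' where *: "0 \<le> m'" "0 \<le> n'" "K (u - m') (v - n')" "less m' n' u v"
        using 1 by (auto simp: A_def)
      then obtain m n where "A m n" "K (m' - m) (n' - n)"
        using 1(1)[of m' n'] by (auto simp: less_def)
      then show ?thesis
        using add[OF *(3)] by (intro exI[of _ m] exI[of _ n]) fastforce
    qed
  qed
  have rep: "\<exists>m n. A m n \<and> K (u - m) (v - n)" for u v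
  proof -
    obtain m' n' where *: "0 \<le> m'" "0 \<le> n'" "K (u - m') (v - n')" using cover by blast
    obtain m n where "A m n" "K (m' - m) (n' - n)" using rep0 * by blast
    then show ?thesis using add[OF *(3)] by (intro exI[of _ m] exI[of _ n]) fastforce
  qed
  have down: "A m' n'" if "A m n" "0 \<le> m'" "m' \<le> m" "0 \<le> n'" "n' \<le> n" for m n m' n'
    unfolding A_def
  proof (intro conjI allI impI that notI)
    fix p q assume *: "0 \<le> p \<and> 0 \<le> q \<and> K (m' - p) (n' - q)" "less p q m' n'"
    have "less (p + (m - m')) (q + (n - n')) m n" using *(2) by (auto simp: less_def)
    moreover have "K (m - (p + (m - m'))) (n - (q + (n - n')))" using * by (simp add: algebra_simps)
    ultimately show False using that * unfolding A_def by (smt (verit))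
  qed
  have unique: "m = m' \<and> n = n'" if "A m n" "A m' n'" "K (m - m') (n - n')" for m n m' n'
    using that neg[OF that(3)] unfolding A_def less_def by (smt (verit))
  have A_le: "m + n \<le> D" if A: "A m n" for m n
  proof -
    obtain m' n' where "0 \<le> m'" "0 \<le> n'" "m' + n' \<le> D" "K (m - m') (n - n')" using cover by blast
    then show ?thesis using A unfolding A_def less_def by (smt (verit))
  qed
  have A00: "A 0 0" unfolding A_def less_def by auto
  have notA: "\<exists>m' n'. 0 \<le> m' \<and> 0 \<le> n' \<and> K (m - m') (n - n') \<and> less m' n' m n"
    if "\<not> A m n" "0 \<le> m" "0 \<le> n" for m n using that by (auto simp: A_def)
  have D1: "\<not> A (D + 1) 0" "\<not> A 0 (D + 1)" "0 \<le> D + 1"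
    using A_le[OF A00] A_le[of "D + 1" 0] A_le[of 0 "D + 1"] by auto
  obtain l where l: "\<not> A l 0" "\<forall>p. 0 \<le> p \<and> p < l \<longrightarrow> A p 0" "1 \<le> l"
    by (rule least_int_counterexample[where P = "\<lambda>p. A p 0", OF A00 D1(1,3)])
  obtain h where h: "\<not> A 0 h" "\<forall>p. 0 \<le> p \<and> p < h \<longrightarrow> A 0 p" "1 \<le> h"
    by (rule least_int_counterexample[where P = "\<lambda>p. A 0 p", OF A00 D1(2,3)])
  have A_box: "m < l \<and> n < h" if "A m n" for m n
    using down[OF that, of l 0] down[OF that, of 0 h] l h A_nonneg[OF that] by force
  have corner: "\<exists>x y. 1 \<le> x \<and> x \<le> p \<and> 1 \<le> y \<and> y \<le> q \<and> \<not> A x y \<and> A (x - 1) y \<and> A x (y - 1)"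
    if "\<not> A p q" "0 \<le> p" "p < l" "0 \<le> q" "q < h" for p q
    using that
  proof (induction "nat (p + q)" arbitrary: p q rule: less_induct)
    case less
    have pq: "1 \<le> p" "1 \<le> q" using l h less.prems by (metis int_one_le_iff_zero_less order_le_less)+
    consider "A (p - 1) q" "A p (q - 1)" | "\<not> A (p - 1) q" | "\<not> A p (q - 1)" by blast
    then show ?case
    proof cases
      case 1
      then show ?thesis using less.prems pq by (intro exI[of _ p] exI[of _ q]) simp
    next
      case 2
      have "\<exists>x y. 1 \<le> x \<and> x \<le> p - 1 \<and> 1 \<le> y \<and> y \<le> q \<and> \<not> A x y \<and> A (x - 1) y \<and> A x (y - 1)"
        by (rule less.hyps[OF _ 2]) (use less.prems pq in auto)
      then obtain x y where "1 \<le> x" "x \<le> p - 1" "1 \<le> y" "y \<le> q" "\<not> A x y" "A (x - 1) y" "A x (y - 1)"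
        by (elim exE conjE)
      then show ?thesis by (intro exI[of _ x] exI[of _ y]) simp
    next
      case 3
      have "\<exists>x y. 1 \<le> x \<and> x \<le> p \<and> 1 \<le> y \<and> y \<le> q - 1 \<and> \<not> A x y \<and> A (x - 1) y \<and> A x (y - 1)"
        by (rule less.hyps[OF _ 3]) (use less.prems pq in auto)
      then obtain x y where "1 \<le> x" "x \<le> p" "1 \<le> y" "y \<le> q - 1" "\<not> A x y" "A (x - 1) y" "A x (y - 1)"
        by (elim exE conjE)
      then show ?thesis by (intro exI[of _ x] exI[of _ y]) simp
    qed
  qed
  \<comment> \<open>A smaller representative \<open>(m, n)\<close> with \<open>m \<ge> 1\<close>
    would give \<open>(m - 1, n)\<close> below \<open>(x - 1, y)\<close>, which is minimal; likewise
    for \<open>n\<close>. Only \<open>(0, 0)\<close> remains.\<close>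
  have corner_K: "K x y" if *: "1 \<le> x" "1 \<le> y" "\<not> A x y" "A (x - 1) y" "A x (y - 1)" for x y
  proof -
    obtain m n where mn: "0 \<le> m" "0 \<le> n" "K (x - m) (y - n)" "less m n x y"
      using notA[of x y] * by auto
    have "m = 0"
    proof (rule ccontr)
      assume "m \<noteq> 0"
      then show False using *(4) mn unfolding A_def less_def
        by (elim conjE allE[of _ "m - 1"] allE[of _ n]) auto
    qed
    moreover have "n = 0"
    proof (rule ccontr)
      assume "n \<noteq> 0"
      then show False using *(5) mn unfolding A_def less_def
        by (elim conjE allE[of _ "m"] allE[of _ "n - 1"]) auto
    qed
    ultimately show ?thesis using mn by simp
  qed
  have corner_unique: False if "K x y" "K x' y'" "1 \<le> x" "x < x'" "x' < l" "1 \<le> y'" "y' < y" "y < h"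
    for x y x' y'
  proof -
    \<comment> \<open>The difference of two corners identifies \<open>(x' - x, 0)\<close> with
      \<open>(0, y - y')\<close>, two distinct minimal representatives on the axes.\<close>
    have "K ((x' - x) - 0) (0 - (y - y'))" using diff[OF that(2,1)] by simp
    then show False using unique[of "x' - x" 0 0 "y - y'"] l(2)[rule_format, of "x' - x"] h(2)[rule_format, of "y - y'"] that by auto
  qed
  \<comment> \<open>The degree bounds come from the outer corners of the L-shape. A rectangle is the
    case \<open>x = 0\<close>, \<open>y = h\<close>.\<close>
  have "\<exists>x y. 0 \<le> x \<and> 0 \<le> y \<and> y \<le> h \<and> l + y \<le> D + 2 \<and> x + h \<le> D + 2 \<and> (\<forall>m n. A m n \<longrightarrow> m < x \<or> n < y)"
  proof (cases "A (l - 1) (h - 1)")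
    case True
    have "m < 0 \<or> n < h" if "A m n" for m n using A_box[OF that] by simp
    then show ?thesis using A_le[OF True] A_le[of 0 "h - 1"] l(3) h(2,3)
      by (intro exI[of _ 0] exI[of _ h] conjI) auto
  next
    case False
    obtain x y where xy: "1 \<le> x" "x \<le> l - 1" "1 \<le> y" "y \<le> h - 1"
      "\<not> A x y" "A (x - 1) y" "A x (y - 1)" using corner[OF False] l h by auto
    have K: "K x y" by (rule corner_K) (use xy in auto)
    have "A (l - 1) (y - 1)"
    proof (rule ccontr)
      assume "\<not> A (l - 1) (y - 1)"
      from corner[OF this] obtain p q where pq: "1 \<le> p" "p \<le> l - 1" "1 \<le> q" "q \<le> y - 1"
        "\<not> A p q" "A (p - 1) q" "A p (q - 1)" using xy by auto
      have "x < p" using pq xy down[OF xy(7), of p q] by force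
      moreover have "K p q" by (rule corner_K) (use pq in auto)
      ultimately show False using corner_unique[OF K, of p q] xy pq by auto
    qed
    moreover have "A (x - 1) (h - 1)"
    proof (rule ccontr)
      assume "\<not> A (x - 1) (h - 1)"
      from corner[OF this] obtain p q where pq: "1 \<le> p" "p \<le> x - 1" "1 \<le> q" "q \<le> h - 1"
        "\<not> A p q" "A (p - 1) q" "A p (q - 1)" using xy by auto
      have "y < q" using pq xy down[OF xy(6), of p q] by force
      moreover have "K p q" by (rule corner_K) (use pq in auto)
      ultimately show False using corner_unique[OF _ K, of p q] xy pq by auto
    qed
    moreover have "m < x \<or> n < y" if "A m n" for m n using down[OF that, of x y] xy by linarith
    ultimately show ?thesis using A_le[of "l - 1" "y - 1"] A_le[of "x - 1" "h - 1"] xy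
      by (intro exI[of _ x] exI[of _ y] conjI) auto
  qed
  then obtain x y where xy: "0 \<le> x" "0 \<le> y" "y \<le> h" "l + y \<le> D + 2" "x + h \<le> D + 2"
    "\<And>m n. A m n \<Longrightarrow> m < x \<or> n < y" by blast
  let ?B = "{0..<l} \<times> {0..<y} \<union> {0..<x} \<times> {y..<h}" and ?T = "{(m, n). A m n}"
  have sub: "?T \<subseteq> ?B" using A_box A_nonneg xy(6) by fastforce
  then have fin: "finite ?T" by (rule finite_subset) auto
  have "card ?T \<le> card ?B" using sub by (intro card_mono) auto
  also have "\<dots> \<le> card ({0..<l} \<times> {0..<y}) + card ({0..<x} \<times> {y..<h})" by (rule card_Un_le)
  finally have "card ?T \<le> nat l * nat y + nat x * nat (h - y)"
    by (simp add: card_cartesian_product)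
  then have "int (card ?T) \<le> int (nat l * nat y + nat x * nat (h - y))" by (rule of_nat_mono)
  also have "\<dots> = l * y + x * (h - y)" using xy l by simp
  finally have "3 * int (card ?T) \<le> 3 * (l * y + x * (h - y))" by (intro mult_left_mono) auto
  then have "3 * int (card ?T) \<le> (D + 2)\<^sup>2"
    by (rule order_trans) (use xy in \<open>intro L_shape_area_bound\<close>)
  moreover have "\<exists>(m, n)\<in>?T. K (u - m) (v - n)" for u v using rep[of u v] by auto
  ultimately show ?thesis using that fin by blast
qed

section \<open>Relations between an involution and two generators\<close>

text \<open>\<open>L e u v\<close> stands for the relation \<open>e \<iota> + u b\<^sub>1 + v b\<^sub>2 = 0\<close>.\<close>

locale word_kernel =
  fixes L :: "int \<Rightarrow> int \<Rightarrow> int \<Rightarrow> bool"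
  assumes zero: "L 0 0 0"
    and diff: "\<And>e u v e' u' v'. L e u v \<Longrightarrow> L e' u' v' \<Longrightarrow> L (e - e') (u - u') (v - v')"
    and two: "L 2 0 0"
    and one: "\<not> L 1 0 0"
begin

lemma neg: "L e u v \<Longrightarrow> L (- e) (- u) (- v)"
  using diff[OF zero] by fastforce

lemma add: "L e u v \<Longrightarrow> L e' u' v' \<Longrightarrow> L (e + e') (u + u') (v + v')"
  using diff[of e u v "- e'" "- u'" "- v'"] neg[of e' u' v'] by simp

lemma mult: "L e u v \<Longrightarrow> L (c * e) (c * u) (c * v)"
proof (induction c rule: int_induct[where k = 0])
  case base
  then show ?case using zero by simp
next
  case (step1 i)
  then show ?case using add[of "i * e" "i * u" "i * v" e u v] by (simp add: algebra_simps)
next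
  case (step2 i)
  then show ?case using diff[of "i * e" "i * u" "i * v" e u v] by (simp add: algebra_simps)
qed

lemma parity:
  assumes "L e u v" "even (e - e')"
  shows "L e' u v"
proof -
  obtain c where "e - e' = c * 2" using assms(2) by (metis dvdE mult.commute)
  then show ?thesis using diff[OF assms(1) mult[OF two, of c]] by (simp add: algebra_simps)
qed

text \<open>This is diameter at most \<open>k\<close>: distances are translation invariant, and one
  copy of \<open>\<iota>\<close> suffices in a shortest word.\<close>

definition covers :: "int \<Rightarrow> bool" where
  "covers k \<longleftrightarrow> (\<forall>e u v. \<exists>e' m n. 0 \<le> e' \<and> e' \<le> 1 \<and> 0 \<le> m \<and> 0 \<le> n \<and> e' + m + n \<le> k \<and>
     L (e - e') (u - m) (v - n))"

text \<open>Leaving \<open>e\<close> free passes to the quotient by the involution.\<close>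

definition quotient_covers :: "int \<Rightarrow> bool" where
  "quotient_covers D \<longleftrightarrow> (\<forall>u v. \<exists>m n e. 0 \<le> m \<and> 0 \<le> n \<and> m + n \<le> D \<and> L e (u - m) (v - n))"

definition represents :: "(int \<times> int \<times> int) set \<Rightarrow> bool" where
  "represents T \<longleftrightarrow> (\<forall>e u v. \<exists>(e', u', v')\<in>T. L (e - e') (u - u') (v - v'))"

lemma represents_quotient:
  assumes "\<forall>u v. \<exists>(m, n)\<in>T. \<exists>e. L e (u - m) (v - n)"
  shows "represents ({0, 1} \<times> T)"
  unfolding represents_def
proof (intro allI)
  fix e u v
  obtain m n e' where T: "(m, n) \<in> T" "L e' (u - m) (v - n)" using assms by blast
  have "even (e' - (e - (e - e') mod 2))" by presburger
  then have "L (e - (e - e') mod 2) (u - m) (v - n)" by (rule parity[OF T(2)])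
  moreover have "(e - e') mod 2 \<in> {0, 1}" by auto
  ultimately show "\<exists>(e', u', v')\<in>{0, 1} \<times> T. L (e - e') (u - u') (v - v')"
    using T(1) by (intro bexI[of _ "((e - e') mod 2, m, n)"]) auto
qed

section \<open>Upper bounds for the number of elements\<close>

lemma represents_of_quotient_cover:
  assumes "quotient_covers (k - 1)"
  obtains T q where "finite T" "represents T" "int (card T) \<le> 2 * q" "3 * q \<le> (k + 1)\<^sup>2"
proof -
  let ?K = "\<lambda>u v. \<exists>e. L e u v"
  have "?K 0 0" using zero by (rule exI)
  moreover have "?K (u - u') (v - v')" if "?K u v" "?K u' v'" for u v u' v'
    using that by (elim exE) (rule exI, rule diff)
  moreover have "\<exists>m n. 0 \<le> m \<and> 0 \<le> n \<and> m + n \<le> k - 1 \<and> ?K (u - m) (v - n)" for u v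
    using assms[unfolded quotient_covers_def, rule_format, of u v] by simp
  ultimately obtain T where T: "finite T" "3 * int (card T) \<le> (k - 1 + 2)\<^sup>2"
    "\<forall>u v. \<exists>(m, n)\<in>T. ?K (u - m) (v - n)"
    by (rule triangle_cover_bound)
  \<comment> \<open>Here \<open>q\<close> counts classes modulo the involution; each has two
    lifts.\<close>
  show ?thesis
    by (rule that[of "{0, 1} \<times> T" "int (card T)"])
      (use T represents_quotient[OF T(3)] in \<open>auto simp: card_cartesian_product add.commute\<close>)
qed

text \<open>Here \<open>n\<close> is the order of \<open>\<delta> = b\<^sub>1 - b\<^sub>2\<close> modulo \<open>\<iota>\<close>, so that \<open>n \<delta> = \<iota>\<close>, and \<open>m\<close> is the order of
  \<open>b\<^sub>2\<close> modulo \<open>\<delta>\<close>, with \<open>m b\<^sub>2 = a \<delta>\<close>; the group has \<open>2 n m\<close> elements \<open>s b\<^sub>2 + p \<delta>\<close>.\<close>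

lemma represents_of_diagonal:
  assumes k: "covers k" and t: "1 \<le> t" "t \<le> k" "L 1 t (- t)"
  obtains T q where "finite T" "represents T" "int (card T) \<le> 2 * q"
    "3 * q \<le> (k + 1)\<^sup>2 \<or> 4 * q \<le> (k + 2)\<^sup>2"
proof -
  \<comment> \<open>These are the \<open>z\<close> with \<open>z \<delta>\<close> equal to
    \<open>0\<close> or \<open>\<iota>\<close>.\<close>
  define K where "K z \<longleftrightarrow> (\<exists>e. L e z (- z))" for z
  have K_diff: "K (z - w)" if "K z" "K w" for z w
    using that diff unfolding K_def by fastforce
  have K_mult: "K (c * z)" if "K z" for c z
    using that mult unfolding K_def by fastforce
  obtain n where n: "\<not> \<not> K n" "\<forall>z. 0 \<le> z \<and> z < n \<longrightarrow> \<not> (1 \<le> z \<and> K z)" "1 \<le> n"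
    using least_int_counterexample[of "\<lambda>z. \<not> (1 \<le> z \<and> K z)" t] t K_def by auto
  have K_dvd: "n dvd z" if "K z" for z
  proof -
    have "K (z mod n)"
      using K_diff[OF that K_mult[of n "z div n"]] n by (simp add: minus_div_mult_eq_mod)
    then have "z mod n = 0" using n(2)[rule_format, of "z mod n"] n(3) pos_mod_sign[of n z] pos_mod_bound[of n z]
      by linarith
    then show ?thesis by (rule mod_0_imp_dvd)
  qed
  have "n dvd t" using K_dvd t K_def by blast
  then have nk: "n \<le> k" using t zdvd_imp_le[of n t] by simp
  \<comment> \<open>If \<open>n \<delta>\<close> were \<open>0\<close>, so would be its multiple
    \<open>t \<delta>\<close>, which is \<open>\<iota>\<close>.\<close>
  have Ln: "L 1 n (- n)"
  proof -
    obtain e where e: "L e n (- n)" using n K_def by blast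
    show ?thesis
    proof (cases "even e")
      case True
      then have "L 0 n (- n)" using parity[OF e, of 0] by simp
      moreover obtain w where "t = n * w" using \<open>n dvd t\<close> by blast
      ultimately have "L 0 t (- t)" using mult[of 0 n "- n" w] by (simp add: mult.commute)
      then show ?thesis using diff[OF t(3)] one by fastforce
    next
      case False
      then show ?thesis using parity[OF e, of 1] by simp
    qed
  qed
  \<comment> \<open>Subtracting a multiple of \<open>Ln\<close> leaves a multiple of
    \<open>\<iota>\<close> alone; its coefficient must be even because
    \<open>\<iota> \<noteq> 0\<close>.\<close>
  have L_dvd: "2 * n dvd z - e * n" if "L e z (- z)" for e z
  proof -
    have "K z" unfolding K_def using that ..
    then have "n dvd z" by (rule K_dvd)
    then obtain w where w: "z = n * w" ..
    have "L (e - w) 0 0" using diff[OF that mult[OF Ln, of w]] w by (simp add: mult.commute)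
    then have "\<not> even (e - w - 1)" using parity[of "e - w" 0 0 1] one by blast
    then have "even (e - w)" by simp
    then obtain c where "e - w = 2 * c" by blast
    then have "e = w + 2 * c" by simp
    then have "z - e * n = 2 * n * (- c)" unfolding w by (simp add: algebra_simps)
    then show ?thesis by (rule dvdI)
  qed
  \<comment> \<open>\<open>P z\<close> means that \<open>z b\<^sub>2\<close> lies in the subgroup
    generated by \<open>\<delta>\<close> and \<open>\<iota>\<close>, where only the total degree of
    a word matters.\<close>
  define P where "P z \<longleftrightarrow> (\<exists>e x. L e x (z - x))" for z
  have P_diff: "P (z - w)" if PP: "P z" "P w" for z w
  proof -
    obtain e x e' x' where "L e x (z - x)" "L e' x' (w - x')" using PP P_def by auto
    from diff[OF this] have "L (e - e') (x - x') ((z - w) - (x - x'))" by (simp add: algebra_simps)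
    then show ?thesis using P_def by blast
  qed
  have P_mult: "P (c * z)" if Pz: "P z" for c z
  proof -
    obtain e x where "L e x (z - x)" using Pz P_def by auto
    from mult[OF this, of c] have "L (c * e) (c * x) (c * z - c * x)" by (simp add: right_diff_distrib)
    then show ?thesis using P_def by blast
  qed
  \<comment> \<open>A word with nonnegative exponents for \<open>- b\<^sub>2\<close> gives a
    relation of positive degree.\<close>
  obtain i where i: "1 \<le> i" "P i"
  proof -
    obtain e' i j where "0 \<le> i" "0 \<le> j" "L (0 - e') (0 - i) (- 1 - j)"
      using k[unfolded covers_def, rule_format, of 0 0 "- 1"] by blast
    then have "P (1 + i + j)" using neg[of "- e'" "- i" "- 1 - j"] unfolding P_def
      by (intro exI[of _ e'] exI[of _ i]) (simp add: algebra_simps)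
    then show ?thesis using that[of "1 + i + j"] \<open>0 \<le> i\<close> \<open>0 \<le> j\<close> by simp
  qed
  obtain m where m: "\<not> \<not> (1 \<le> m \<and> P m)" "\<forall>z. 0 \<le> z \<and> z < m \<longrightarrow> \<not> (1 \<le> z \<and> P z)" "1 \<le> m"
    using least_int_counterexample[of "\<lambda>z. \<not> (1 \<le> z \<and> P z)" i] i by auto
  have P_dvd: "m dvd z" if "P z" for z
  proof -
    have "P (z mod m)"
      using P_diff[OF that P_mult[of m "z div m"]] m by (simp add: minus_div_mult_eq_mod)
    then have "z mod m = 0" using m(2)[rule_format, of "z mod m"] m(3) pos_mod_sign[of m z] pos_mod_bound[of m z]
      by linarith
    then show ?thesis by (rule mod_0_imp_dvd)
  qed
  \<comment> \<open>The copies of \<open>\<iota>\<close> are absorbed by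
    \<open>n \<delta> = \<iota>\<close>, so that the relation reads
    \<open>m b\<^sub>2 = a \<delta>\<close>.\<close>
  obtain a where a: "L 0 (- a) (m + a)"
  proof -
    obtain e x where "L e x (m - x)" using m P_def by blast
    from diff[OF this mult[OF Ln, of e]] have "L 0 (- (e * n - x)) (m + (e * n - x))"
      by (simp add: algebra_simps)
    then show ?thesis by (rule that)
  qed
  have "3 * (n * m) \<le> (k + 1)\<^sup>2 \<or> 4 * (n * m) \<le> (k + 2)\<^sup>2"
  proof (rule arc_cover_bound[where a = a])
    fix s p assume s: "0 \<le> s" "s < m"
    \<comment> \<open>A word for
      \<open>s b\<^sub>2 + p \<delta> = p b\<^sub>1 + (s - p) b\<^sub>2\<close> has degree
      \<open>s\<close> modulo \<open>m\<close>; the number of excess turns is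
      \<open>c\<close>.\<close>
    obtain e i j where *: "0 \<le> e" "e \<le> 1" "0 \<le> i" "0 \<le> j" "e + i + j \<le> k" "L (0 - e) (p - i) (s - p - j)"
      using k[unfolded covers_def, rule_format, of 0 p "s - p"] by blast
    have "P (s - (i + j))" unfolding P_def using *(6)
      by (intro exI[of _ "0 - e"] exI[of _ "p - i"]) (simp add: algebra_simps)
    then have "m dvd (s - (i + j))" by (rule P_dvd)
    then obtain c' where "s - (i + j) = m * c'" by blast
    then obtain c where c: "s + c * m = i + j" using that[of "- c'"] by (simp add: algebra_simps)
    have "(-1) * m < c * m" using c * s by linarith
    then have "0 \<le> c" using m(3) mult_less_cancel_right_pos[of m "-1" c] by linarith
    have "L (0 - e + c * 0) (p - i + c * (- a)) (s - p - j + c * (m + a))"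
      by (rule add[OF *(6) mult[OF a]])
    moreover have "s - p - j + c * (m + a) = - (p - c * a - i)" using c by (simp add: algebra_simps)
    moreover have "p - i + c * (- a) = p - c * a - i" "0 - e + c * 0 = - e" by simp_all
    ultimately have "L (- e) (p - c * a - i) (- (p - c * a - i))" by (simp only:)
    then have "2 * n dvd p - c * a - i - (- e) * n" by (rule L_dvd)
    then have "2 * n dvd p - c * a - i - (- e) * n - 2 * n * e" by (rule dvd_diff) simp
    then have "2 * n dvd p - c * a - i - e * n" by (simp add: algebra_simps)
    then show "\<exists>c i e. 0 \<le> c \<and> 0 \<le> i \<and> i \<le> s + c * m \<and> 0 \<le> e \<and> e \<le> 1 \<and> s + c * m + e \<le> k \<and>
        2 * n dvd p - c * a - i - e * n"
      using * c \<open>0 \<le> c\<close> by (intro exI[of _ c] exI[of _ i] exI[of _ e]) auto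
  qed (use m n nk in auto)
  moreover
  let ?T = "(\<lambda>(p, s). (0 :: int, p, s - p)) ` ({0..<2 * n} \<times> {0..<m})"
  have "represents ?T"
    unfolding represents_def
  proof (intro allI)
    fix e u v
    define c s z p w where "c = (u + v) div m" and "s = (u + v) mod m" and "z = u + c * a - e * n"
      and "p = z mod (2 * n)" and "w = z div (2 * n)"
    have uv: "u + v = c * m + s" unfolding c_def s_def by simp
    have z: "z = w * (2 * n) + p" unfolding p_def w_def by (simp only: div_mult_mod_eq)
    have "L (c * 0 + e * 1 + w * 2) (c * (- a) + e * n + w * (2 * n)) (c * (m + a) + e * (- n) + w * (2 * (- n)))"
      using add[OF add[OF mult[OF a, of c] mult[OF Ln, of e]] mult[OF mult[OF Ln, of 2], of w]] by simp
    moreover have "c * (- a) + e * n + w * (2 * n) = u - p" using z unfolding z_def by simp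
    moreover have "c * (m + a) + e * (- n) + w * (2 * (- n)) = v - (s - p)"
      using z uv unfolding z_def by (simp add: algebra_simps)
    ultimately have "L (e + w * 2) (u - p) (v - (s - p))" by simp
    then have "L (e - 0) (u - p) (v - (s - p))" by (rule parity) simp
    moreover have "(p, s) \<in> {0..<2 * n} \<times> {0..<m}" using m(3) n(3) unfolding p_def s_def by simp
    ultimately show "\<exists>(e', u', v')\<in>?T. L (e - e') (u - u') (v - v')"
      by (intro bexI[of _ "(0, p, s - p)"]) auto
  qed
  moreover have "int (card ?T) \<le> 2 * (n * m)"
  proof -
    have "card ?T \<le> card ({0..<2 * n} \<times> {0..<m})" by (rule card_image_le) simp
    also have "\<dots> = nat (2 * n) * nat m" by (simp add: card_cartesian_product)
    also have "\<dots> = nat (2 * n * m)" using n by (simp add: nat_mult_distrib)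
    finally show ?thesis using mult_nonneg_nonneg[of n m] n(3) m(3) by linarith
  qed
  moreover have "finite ?T" by simp
  ultimately show ?thesis using that[of ?T "n * m"] by blast
qed

lemma represents_of_cover:
  assumes k: "covers k"
  obtains T q where "finite T" "represents T" "int (card T) \<le> 2 * q"
    "3 * q \<le> (k + 1)\<^sup>2 \<or> 4 * q \<le> (k + 2)\<^sup>2"
proof (cases "quotient_covers (k - 1)")
  case True
  then show ?thesis using represents_of_quotient_cover[of k] that by metis
next
  case False
  then obtain u v where uv: "\<And>m n e. 0 \<le> m \<Longrightarrow> 0 \<le> n \<Longrightarrow> L e (u - m) (v - n) \<Longrightarrow> k - 1 < m + n"
    unfolding quotient_covers_def by (meson not_le)
  \<comment> \<open>A word using \<open>\<iota>\<close> would reach the class of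
    \<open>(u, v)\<close> in at most \<open>k - 1\<close> steps, so both lifts need
    \<open>e' = 0\<close> and exactly \<open>k\<close> generators.\<close>
  have "\<exists>m n. 0 \<le> m \<and> 0 \<le> n \<and> m + n = k \<and> L e (u - m) (v - n)" for e
  proof -
    obtain e' m n where *: "0 \<le> e'" "0 \<le> m" "0 \<le> n" "e' + m + n \<le> k" "L (e - e') (u - m) (v - n)"
      using k[unfolded covers_def, rule_format, of e u v] by blast
    with uv[OF *(2,3,5)] have "e' = 0" "m + n = k" by auto
    then show ?thesis using * by auto
  qed
  then obtain m n m' n' where *: "0 \<le> m" "0 \<le> n" "m + n = k" "L 1 (u - m) (v - n)"
    "0 \<le> m'" "0 \<le> n'" "m' + n' = k" "L 0 (u - m') (v - n')" by metis
  define t where "t = m' - m"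
  have "(v - n) - (v - n') = - t" "(u - m) - (u - m') = t" using * by (simp_all add: t_def)
  then have t: "L 1 t (- t)" using diff[OF *(4,8)] by simp
  have t': "L 1 (- t) t" using parity[OF neg[OF t], of 1] by simp
  have "t \<noteq> 0" using t one by auto
  moreover have "\<bar>t\<bar> \<le> k" using * unfolding t_def by linarith
  ultimately have "1 \<le> \<bar>t\<bar> \<and> \<bar>t\<bar> \<le> k \<and> L 1 \<bar>t\<bar> (- \<bar>t\<bar>)" using t t' by (cases "0 \<le> t") auto
  then show ?thesis by (elim conjE) (rule represents_of_diagonal[OF k _ _ _ that])
qed

section \<open>Covers from relations, and degenerate generators\<close>

lemma covers_of_quotient_covers:
  assumes "quotient_covers (k - 1)"
  shows "covers k"
  unfolding covers_def
proof (intro allI)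
  fix e u v
  obtain m n e' where *: "0 \<le> m" "0 \<le> n" "m + n \<le> k - 1" "L e' (u - m) (v - n)"
    using assms[unfolded quotient_covers_def, rule_format, of u v] by (elim exE conjE)
  \<comment> \<open>The spare step is spent on \<open>\<iota>\<close> exactly when the lift found
    has the wrong parity.\<close>
  have "even (e' - (e - (e - e') mod 2))" by presburger
  then have "L (e - (e - e') mod 2) (u - m) (v - n)" by (rule parity[OF *(4)])
  moreover have "0 \<le> (e - e') mod 2" "(e - e') mod 2 \<le> 1" by simp_all
  ultimately show "\<exists>e' m n. 0 \<le> e' \<and> e' \<le> 1 \<and> 0 \<le> m \<and> 0 \<le> n \<and> e' + m + n \<le> k \<and>
      L (e - e') (u - m) (v - n)"
    using * by (intro exI[of _ "(e - e') mod 2"] exI[of _ m] exI[of _ n] conjI) auto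
qed

text \<open>The relations act as rewriting rules: \<open>(p, q)\<close> to \<open>(0, 0)\<close>,
  \<open>(0, h)\<close> to \<open>(h', 0)\<close> and, by their difference,
  \<open>(p + h', 0)\<close> to \<open>(0, h - q)\<close>. Each lowers the degree, and irreducible
  words lie in an L-shape with corners of degree at most \<open>D\<close>. The period
  \<open>M\<close> makes the exponents nonnegative at the start.\<close>

lemma quotient_covers_of_relations:
  assumes pq: "0 \<le> p" "0 \<le> q" "0 < p + q" "L e1 p q"
    and h: "0 \<le> h'" "h' < h" "L e2 (- h') h"
    and l: "q \<le> h" "h < p + q + h'"
    and D: "p + q + h' \<le> D + 2" "p + h \<le> D + 2"
    and M: "0 < M" "L 0 M 0" "L 0 0 M"
  shows "quotient_covers D"
proof -
  define l where "l = p + h'"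
  define l' where "l' = h - q"
  have l: "0 \<le> l'" "l' < l" "L (e1 - e2) l (- l')" "l + q \<le> D + 2"
    using assms diff[OF pq(4) h(3)] by (auto simp: l_def l'_def)
  have reduce: "\<exists>m' n' e. 0 \<le> m' \<and> 0 \<le> n' \<and> m' + n' \<le> D \<and> L e (m - m') (n - n')"
    if "0 \<le> m" "0 \<le> n" for m n
    using that
  proof (induction "nat (m + n)" arbitrary: m n rule: less_induct)
    case less
    have step: ?case if *: "0 \<le> x" "0 \<le> y" "x + y < m + n" "L e (m - x) (n - y)" for x y e
    proof -
      obtain m' n' e' where "0 \<le> m'" "0 \<le> n'" "m' + n' \<le> D" "L e' (x - m') (y - n')"
        using less.hyps[of x y] * by auto
      moreover from this have "L (e + e') (m - m') (n - n')" using add[OF *(4)] by fastforce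
      ultimately show ?case by (intro exI conjI)
    qed
    consider "l \<le> m" | "h \<le> n" | "p \<le> m" "q \<le> n" | "m < l" "n < q" | "m < p" "n < h" by linarith
    then show ?case
    proof cases
      case 1 then show ?thesis using step[of "m - l" "n + l'"] l less.prems by auto
    next
      case 2 then show ?thesis using step[of "m + h'" "n - h"] h less.prems by auto
    next
      case 3 then show ?thesis using step[of "m - p" "n - q"] pq less.prems by auto
    next
      case 4 then show ?thesis using less.prems zero l by (intro exI[of _ m] exI[of _ n] exI[of _ 0]) auto
    next
      case 5 then show ?thesis using less.prems zero D by (intro exI[of _ m] exI[of _ n] exI[of _ 0]) auto
    qed
  qed
  show ?thesis
    unfolding quotient_covers_def
  proof (intro allI)
    fix u v
    obtain m' n' e where *: "0 \<le> m'" "0 \<le> n'" "m' + n' \<le> D" "L e (u mod M - m') (v mod M - n')"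
      using reduce[of "u mod M" "v mod M"] M by auto
    have "L 0 (u div M * M) (v div M * M)"
      using add[OF mult[OF M(2), of "u div M"] mult[OF M(3), of "v div M"]] by simp
    from add[OF this *(4)] have "L e (u - m') (v - n')"
      by (simp add: add_diff_eq)
    with * show "\<exists>m n e. 0 \<le> m \<and> 0 \<le> n \<and> m + n \<le> D \<and> L e (u - m) (v - n)" by blast
  qed
qed

text \<open>This excludes degenerate generators: each of the short relations leaves at most
  \<open>2 k\<close> values modulo \<open>\<iota>\<close> for words of length below
  \<open>k\<close>.\<close>

lemma represents_of_short_relation:
  assumes cov: "quotient_covers (k - 1)"
    and short: "L 0 2 0 \<or> L 0 0 2 \<or> L 0 1 1 \<or> L 0 1 (- 1)"
  obtains T where "finite T" "represents T" "int (card T) \<le> 4 * k"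
proof -
  note result = that
  have k: "1 \<le> k"
    using cov[unfolded quotient_covers_def, rule_format, of 0 0] by (elim exE) linarith
  have reduce: "\<exists>e. L e (u - m') (v - n')" if "L e (u - m) (v - n)" "L 0 (m - m') (n - n')" for e u v m n m' n'
    using add[OF that] by (auto simp: algebra_simps)
  have *: thesis if T: "finite T" "card T \<le> 2 * nat k"
    and red: "\<And>m n. 0 \<le> m \<Longrightarrow> 0 \<le> n \<Longrightarrow> m + n \<le> k - 1 \<Longrightarrow> \<exists>(m', n')\<in>T. L 0 (m - m') (n - n')" for T
  proof -
    have "\<forall>u v. \<exists>(m, n)\<in>T. \<exists>e. L e (u - m) (v - n)"
    proof (intro allI)
      fix u v
      obtain m n e where mn: "0 \<le> m" "0 \<le> n" "m + n \<le> k - 1" "L e (u - m) (v - n)"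
        using cov[unfolded quotient_covers_def, rule_format, of u v] by (elim exE conjE)
      then obtain m' n' where "(m', n') \<in> T" "L 0 (m - m') (n - n')" using red[of m n] by auto
      with reduce[OF mn(4)] show "\<exists>(m, n)\<in>T. \<exists>e. L e (u - m) (v - n)" by blast
    qed
    from represents_quotient[OF this] show ?thesis
      using T k by (intro result[of "{0, 1} \<times> T"]) (auto simp: card_cartesian_product)
  qed
  from short consider "L 0 2 0" | "L 0 0 2" | "L 0 1 1" | "L 0 1 (- 1)" by blast
  then show ?thesis
  proof cases
    case 1
    show ?thesis
    proof (rule *[of "{0, 1} \<times> {0..k - 1}"])
      fix m n :: int assume mn: "0 \<le> m" "0 \<le> n" "m + n \<le> k - 1"
      have "L 0 (m div 2 * 2) 0" using mult[OF 1, of "m div 2"] by simp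
      then have "L 0 (m - m mod 2) (n - n)" by (simp add: minus_mod_eq_div_mult)
      moreover have "m mod 2 \<in> {0, 1}" by auto
      ultimately show "\<exists>(m', n')\<in>{0, 1} \<times> {0..k - 1}. L 0 (m - m') (n - n')"
        using mn by (intro bexI[of _ "(m mod 2, n)"]) auto
    qed (auto simp: card_cartesian_product)
  next
    case 2
    show ?thesis
    proof (rule *[of "{0..k - 1} \<times> {0, 1}"])
      fix m n :: int assume mn: "0 \<le> m" "0 \<le> n" "m + n \<le> k - 1"
      have "L 0 0 (n div 2 * 2)" using mult[OF 2, of "n div 2"] by simp
      then have "L 0 (m - m) (n - n mod 2)" by (simp add: minus_mod_eq_div_mult)
      moreover have "n mod 2 \<in> {0, 1}" by auto
      ultimately show "\<exists>(m', n')\<in>{0..k - 1} \<times> {0, 1}. L 0 (m - m') (n - n')"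
        using mn by (intro bexI[of _ "(m, n mod 2)"]) auto
    qed (auto simp: card_cartesian_product)
  next
    case 3
    show ?thesis
    proof (rule *[of "{0} \<times> {- (k - 1)..k - 1}"])
      fix m n :: int assume mn: "0 \<le> m" "0 \<le> n" "m + n \<le> k - 1"
      have "L 0 (m - 0) (n - (n - m))" using mult[OF 3, of m] by simp
      then show "\<exists>(m', n')\<in>{0} \<times> {- (k - 1)..k - 1}. L 0 (m - m') (n - n')"
        using mn by (intro bexI[of _ "(0, n - m)"]) auto
    qed (use k in \<open>auto simp: card_cartesian_product\<close>)
  next
    case 4
    show ?thesis
    proof (rule *[of "{0} \<times> {0..k - 1}"])
      fix m n :: int assume mn: "0 \<le> m" "0 \<le> n" "m + n \<le> k - 1"
      have "L 0 (m - 0) (n - (n + m))" using mult[OF 4, of m] by simp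
      then show "\<exists>(m', n')\<in>{0} \<times> {0..k - 1}. L 0 (m - m') (n - n')"
        using mn by (intro bexI[of _ "(0, n + m)"]) auto
    qed (use k in \<open>auto simp: card_cartesian_product\<close>)
  qed
qed

end

section \<open>Walks in the Cayley graph\<close>

lemma wf_cayley_graph:
  assumes "group G" "S \<subseteq> carrier G"
  shows "wf_digraph (with_proj (cayley_graph G S))"
proof -
  interpret group G by fact
  show ?thesis
    using assms(2) by unfold_locales (auto simp: cayley_graph_def)
qed

definition word :: "('a, 'm) monoid_scheme \<Rightarrow> 'a \<Rightarrow> 'a \<Rightarrow> 'a \<Rightarrow> int \<Rightarrow> int \<Rightarrow> int \<Rightarrow> 'a" where
  "word G i b1 b2 e u v = i [^]\<^bsub>G\<^esub> e \<otimes>\<^bsub>G\<^esub> b1 [^]\<^bsub>G\<^esub> u \<otimes>\<^bsub>G\<^esub> b2 [^]\<^bsub>G\<^esub> v"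

definition word_cover :: "('a, 'm) monoid_scheme \<Rightarrow> 'a \<Rightarrow> 'a \<Rightarrow> 'a \<Rightarrow> int \<Rightarrow> bool" where
  "word_cover G i b1 b2 k \<longleftrightarrow> (\<forall>g\<in>carrier G. \<exists>e m n. 0 \<le> e \<and> e \<le> 1 \<and> 0 \<le> m \<and> 0 \<le> n \<and>
     e + m + n \<le> k \<and> g = word G i b1 b2 e m n)"

locale involution_group = comm_group G for G (structure) +
  fixes i b1 b2
  assumes closed [simp]: "i \<in> carrier G" "b1 \<in> carrier G" "b2 \<in> carrier G"
    and invol: "i \<otimes> i = \<one>"
begin

abbreviation "w \<equiv> word G i b1 b2"

lemma w_closed [simp]: "w e u v \<in> carrier G"
  by (simp add: word_def)

lemma w_add: "w (e + e') (u + u') (v + v') = w e u v \<otimes> w e' u' v'"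
  by (simp add: word_def int_pow_mult m_ac)

lemma w_0 [simp]: "w 0 0 0 = \<one>"
  by (simp add: word_def)

lemma w_generators: "w 1 0 0 = i" "w 0 1 0 = b1" "w 0 0 1 = b2"
  by (simp_all add: word_def int_pow_1)

lemma w_2 [simp]: "w 2 0 0 = \<one>"
  using w_add[of 1 1 0 0 0 0] invol by (simp add: w_generators)

lemma w_diff: "w (e - e') (u - u') (v - v') = w e u v \<otimes> inv (w e' u' v')"
  using w_add[of "e - e'" e' "u - u'" u' "v - v'" v']
  by (simp add: inv_solve_right)

lemma w_eq_iff: "w e u v = w e' u' v' \<longleftrightarrow> w (e - e') (u - u') (v - v') = \<one>"
  unfolding w_diff by (metis inv_solve_right' l_one one_closed w_closed)

abbreviation "cay \<equiv> with_proj (cayley_graph G {i, b1, b2})"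

sublocale cay: wf_digraph cay
  by (rule wf_cayley_graph) (auto intro: is_group)

lemma cay_verts [simp]: "pverts (cayley_graph G {i, b1, b2}) = carrier G"
  by (simp add: cayley_graph_def)

lemma cay_arcs: "(x, y) \<in> parcs (cayley_graph G {i, b1, b2}) \<longleftrightarrow>
    x \<in> carrier G \<and> y \<in> {x \<otimes> i, x \<otimes> b1, x \<otimes> b2}"
  by (auto simp: cayley_graph_def)

text \<open>Commutativity collects the steps, and two involution steps cancel; hence
  \<open>e \<le> 1\<close> and only an inequality for the length.\<close>

lemma awalk_word:
  assumes "cay.awalk x p y"
  shows "\<exists>e m n. 0 \<le> e \<and> e \<le> 1 \<and> 0 \<le> m \<and> 0 \<le> n \<and> e + m + n \<le> int (length p) \<and> y = x \<otimes> w e m n"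
  using assms
proof (induction p arbitrary: x)
  case Nil
  then show ?case by (intro exI[of _ 0]) (auto simp: cay.awalk_Nil_iff)
next
  case (Cons a p)
  obtain z where a: "a = (x, z)" "(x, z) \<in> parcs (cayley_graph G {i, b1, b2})" "cay.awalk z p y"
    using Cons.prems by (cases a) (auto simp: cay.awalk_Cons_iff)
  obtain e m n where emn: "0 \<le> e" "e \<le> 1" "0 \<le> m" "0 \<le> n" "e + m + n \<le> int (length p)" "y = z \<otimes> w e m n"
    using Cons.IH[OF a(3)] by blast
  have x: "x \<in> carrier G" using a by (simp add: cay_arcs)
  consider "z = x \<otimes> w 1 0 0" | "z = x \<otimes> w 0 1 0" | "z = x \<otimes> w 0 0 1"
    using a(2) by (auto simp: cay_arcs w_generators)
  then show ?case
  proof cases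
    case 1
    then have y: "y = x \<otimes> w (1 + e) m n" using emn x w_add[of 1 e 0 m 0 n] by (simp add: m_assoc)
    show ?thesis
    proof (cases "e = 0")
      case True
      then show ?thesis using y emn by (intro exI[of _ 1] exI[of _ m] exI[of _ n]) auto
    next
      case False
      then have "1 + e = 2" using emn by simp
      then have "y = x \<otimes> w 0 m n" using y w_add[of 2 0 0 m 0 n] by simp
      then show ?thesis using emn by (intro exI[of _ 0] exI[of _ m] exI[of _ n]) auto
    qed
  next
    case 2
    then have "y = x \<otimes> w e (1 + m) n" using emn x w_add[of 0 e 1 m 0 n] by (simp add: m_assoc)
    then show ?thesis using emn by (intro exI[of _ e] exI[of _ "1 + m"] exI[of _ n]) auto
  next
    case 3
    then have "y = x \<otimes> w e m (1 + n)" using emn x w_add[of 0 e 0 m 1 n] by (simp add: m_assoc)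
    then show ?thesis using emn by (intro exI[of _ e] exI[of _ m] exI[of _ "1 + n"]) auto
  qed
qed

lemma awalk_snoc:
  assumes "cay.awalk x p y" "s \<in> {i, b1, b2}"
  shows "cay.awalk x (p @ [(y, y \<otimes> s)]) (y \<otimes> s)"
proof -
  have "y \<in> carrier G" using cay.awalk_last_in_verts[OF assms(1)] by simp
  then have "cay.awalk y [(y, y \<otimes> s)] (y \<otimes> s)"
    using assms(2) by (auto simp: cay.awalk_Cons_iff cay.awalk_Nil_iff cay_arcs)
  then show ?thesis by (rule cay.awalk_appendI[OF assms(1)])
qed

lemma word_awalk:
  assumes x: "x \<in> carrier G"
  shows "\<exists>p. cay.awalk x p (x \<otimes> w (int e) (int m) (int n)) \<and> length p = e + m + n"
proof (induction n)
  case 0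
  show ?case
  proof (induction m)
    case 0
    show ?case
    proof (induction e)
      case 0
      then show ?case using x by (intro exI[of _ "[]"]) (simp add: cay.awalk_Nil_iff)
    next
      case (Suc e)
      then obtain p where p: "cay.awalk x p (x \<otimes> w (int e) 0 0)" "length p = e" by auto
      have "x \<otimes> w (int e) 0 0 \<otimes> i = x \<otimes> w (int (Suc e)) 0 0"
        using w_add[of "int e" 1 0 0 0 0] x by (simp add: m_assoc w_generators add.commute)
      then show ?case using awalk_snoc[OF p(1), of i] p(2)
        by (intro exI[of _ "p @ [(x \<otimes> w (int e) 0 0, x \<otimes> w (int e) 0 0 \<otimes> i)]"]) simp
    qed
  next
    case (Suc m)
    then obtain p where p: "cay.awalk x p (x \<otimes> w (int e) (int m) 0)" "length p = e + m" by auto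
    have "x \<otimes> w (int e) (int m) 0 \<otimes> b1 = x \<otimes> w (int e) (int (Suc m)) 0"
      using w_add[of "int e" 0 "int m" 1 0 0] x by (simp add: m_assoc w_generators add.commute)
    then show ?case using awalk_snoc[OF p(1), of b1] p(2)
      by (intro exI[of _ "p @ [(x \<otimes> w (int e) (int m) 0, x \<otimes> w (int e) (int m) 0 \<otimes> b1)]"]) simp
  qed
next
  case (Suc n)
  then obtain p where p: "cay.awalk x p (x \<otimes> w (int e) (int m) (int n))" "length p = e + m + n" by auto
  have "x \<otimes> w (int e) (int m) (int n) \<otimes> b2 = x \<otimes> w (int e) (int m) (int (Suc n))"
    using w_add[of "int e" 0 "int m" 0 "int n" 1] x by (simp add: m_assoc w_generators add.commute)
  then show ?case using awalk_snoc[OF p(1), of b2] p(2)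
    by (intro exI[of _ "p @ [(x \<otimes> w (int e) (int m) (int n), x \<otimes> w (int e) (int m) (int n) \<otimes> b2)]"]) simp
qed

lemma awalk_cost_length: "cay.awalk_cost (\<lambda>_. 1) p = real (length p)"
  by (induction p) (auto simp: cay.awalk_cost_def)

lemma dist_conv: "digraph_dist cay x y = (INF p\<in>{p. cay.awalk x p y}. ereal (real (length p)))"
  unfolding digraph_dist_def cay.\<mu>_def awalk_cost_length ..

text \<open>Translations are automorphisms: \<open>x\<close> reaches \<open>y\<close> as
  \<open>\<one>\<close> reaches \<open>inv x \<otimes> y\<close>.\<close>

lemma diameter_le_iff:
  "digraph_diameter cay \<le> ereal (real k) \<longleftrightarrow> word_cover G i b1 b2 (int k)"
proof
  assume le: "digraph_diameter cay \<le> ereal (real k)"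
  show "word_cover G i b1 b2 (int k)"
    unfolding word_cover_def
  proof
    fix g assume g: "g \<in> carrier G"
    have "digraph_dist cay \<one> g \<le> digraph_diameter cay"
      unfolding digraph_diameter_def using g by (intro SUP_upper2[of \<one>] SUP_upper2[of g]) auto
    with le have "digraph_dist cay \<one> g \<le> ereal (real k)" by (rule order_trans[rotated])
    \<comment> \<open>The strict bound yields an actual walk from the infimum, and a length below
      \<open>k + 1\<close> is at most \<open>k\<close>.\<close>
    also have "\<dots> < ereal (real (Suc k))" by simp
    finally obtain p where p: "cay.awalk \<one> p g" "length p < Suc k"
      unfolding dist_conv by (auto simp: INF_less_iff)
    from awalk_word[OF p(1)] obtain e m n where
      "0 \<le> e" "e \<le> 1" "0 \<le> m" "0 \<le> n" "e + m + n \<le> int (length p)" "g = \<one> \<otimes> w e m n" by blast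
    then show "\<exists>e m n. 0 \<le> e \<and> e \<le> 1 \<and> 0 \<le> m \<and> 0 \<le> n \<and> e + m + n \<le> int k \<and> g = w e m n"
      using p(2) by (intro exI[of _ e] exI[of _ m] exI[of _ n]) auto
  qed
next
  assume cover: "word_cover G i b1 b2 (int k)"
  have "digraph_dist cay x y \<le> ereal (real k)" if xy: "x \<in> carrier G" "y \<in> carrier G" for x y
  proof -
    obtain e m n where *: "0 \<le> e" "e \<le> 1" "0 \<le> m" "0 \<le> n" "e + m + n \<le> int k" "inv x \<otimes> y = w e m n"
      using cover[unfolded word_cover_def, rule_format, of "inv x \<otimes> y"] xy by auto
    have "y = x \<otimes> w e m n" using xy *(6) by (metis inv_closed inv_solve_left m_closed)
    then obtain p where p: "cay.awalk x p y" "length p = nat e + nat m + nat n"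
      using word_awalk[OF xy(1), of "nat e" "nat m" "nat n"] * by auto
    have "length p \<le> k" using p(2) * by linarith
    then show ?thesis unfolding dist_conv using p(1) by (intro INF_lower2[of p]) auto
  qed
  then show "digraph_diameter cay \<le> ereal (real k)"
    unfolding digraph_diameter_def by (auto intro!: SUP_least)
qed

lemma diameter_eq:
  assumes "word_cover G i b1 b2 (int k)" "1 \<le> k" "\<not> word_cover G i b1 b2 (int k - 1)"
  shows "digraph_diameter cay = ereal (real k)"
proof (rule antisym)
  obtain g where g: "g \<in> carrier G" "\<And>e m n. 0 \<le> e \<Longrightarrow> e \<le> 1 \<Longrightarrow> 0 \<le> m \<Longrightarrow> 0 \<le> n \<Longrightarrow>
      e + m + n \<le> int k - 1 \<Longrightarrow> g \<noteq> w e m n"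
    using assms(3) unfolding word_cover_def by blast
  have "k \<le> length p" if "cay.awalk \<one> p g" for p
  proof -
    from awalk_word[OF that] obtain e m n where
      *: "0 \<le> e" "e \<le> 1" "0 \<le> m" "0 \<le> n" "e + m + n \<le> int (length p)" "g = \<one> \<otimes> w e m n" by blast
    with g(2)[OF *(1-4)] show ?thesis by force
  qed
  then have "ereal (real k) \<le> digraph_dist cay \<one> g"
    unfolding dist_conv by (intro INF_greatest) auto
  also have "\<dots> \<le> digraph_diameter cay"
    unfolding digraph_diameter_def using g by (intro SUP_upper2[of \<one>] SUP_upper2[of g]) auto
  finally show "ereal (real k) \<le> digraph_diameter cay" .
qed (use assms diameter_le_iff in simp)

end

section \<open>Bounds for the order\<close>

text \<open>The second term exceeds the first one for \<open>k \<le> 4\<close> only.\<close>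

definition max_order :: "nat \<Rightarrow> nat" where
  "max_order k = 2 * max ((k + 1)\<^sup>2 div 3) ((k + 2)\<^sup>2 div 4)"

text \<open>Modulo the involution, the relations \<open>p b\<^sub>1 + q b\<^sub>2 = 0\<close> and \<open>h b\<^sub>2 = h' b\<^sub>1\<close>, with difference
  \<open>(p + h') b\<^sub>1 = (h - q) b\<^sub>2\<close>, reduce every word to the L-shape
  \<open>[0, p + h') \<times> [0, q) \<union> [0, p) \<times> [0, h)\<close>, whose corners have degree at most \<open>k - 1\<close>.\<close>

definition admissible_L_shape :: "nat \<Rightarrow> nat \<Rightarrow> int \<Rightarrow> int \<Rightarrow> int \<Rightarrow> int \<Rightarrow> bool" where
  "admissible_L_shape k N p q h' h \<longleftrightarrow>
     0 \<le> p \<and> 0 \<le> q \<and> 0 < p + q \<and> 0 \<le> h' \<and> h' < h \<and> q \<le> h \<and> h < p + q + h' \<and>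
     p + q + h' \<le> int k + 1 \<and> p + h \<le> int k + 1 \<and> 1 \<le> k \<and>
     max_order (k - 1) < N \<and> 4 * k < N"

locale involution_pair = involution_group +
  assumes finite_carrier: "finite (carrier G)" and i_neq_one: "i \<noteq> \<one>"
begin

sublocale K: word_kernel "\<lambda>e u v. w e u v = \<one>"
  by unfold_locales (simp_all add: w_diff w_generators i_neq_one)

lemma covers_of_word_cover:
  assumes "word_cover G i b1 b2 k"
  shows "K.covers k"
  unfolding K.covers_def
proof (intro allI)
  fix e u v
  obtain e' m n where "0 \<le> e'" "e' \<le> 1" "0 \<le> m" "0 \<le> n" "e' + m + n \<le> k" "w e u v = w e' m n"
    using assms[unfolded word_cover_def, rule_format, of "w e u v"] by auto
  then show "\<exists>e' m n. 0 \<le> e' \<and> e' \<le> 1 \<and> 0 \<le> m \<and> 0 \<le> n \<and> e' + m + n \<le> k \<and>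
      w (e - e') (u - m) (v - n) = \<one>"
    unfolding w_eq_iff by (intro exI conjI)
qed

lemma word_cover_of_covers:
  assumes gen: "\<And>g. g \<in> carrier G \<Longrightarrow> \<exists>e u v. g = w e u v" and "K.covers k"
  shows "word_cover G i b1 b2 k"
  unfolding word_cover_def
proof
  fix g assume "g \<in> carrier G"
  then obtain e u v where g: "g = w e u v" using gen by blast
  obtain e' m n where *: "0 \<le> e'" "e' \<le> 1" "0 \<le> m" "0 \<le> n" "e' + m + n \<le> k"
    "w (e - e') (u - m) (v - n) = \<one>"
    using assms(2)[unfolded K.covers_def, rule_format, of e u v] by (elim exE conjE)
  from *(6) have "g = w e' m n" unfolding g w_eq_iff .
  with * show "\<exists>e m n. 0 \<le> e \<and> e \<le> 1 \<and> 0 \<le> m \<and> 0 \<le> n \<and> e + m + n \<le> k \<and> g = w e m n"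
    by (intro exI conjI)
qed

lemma order_le_card:
  assumes gen: "\<And>g. g \<in> carrier G \<Longrightarrow> \<exists>e u v. g = w e u v"
    and T: "finite T" "K.represents T"
  shows "order G \<le> card T"
proof -
  have "carrier G \<subseteq> (\<lambda>(e, u, v). w e u v) ` T"
  proof
    fix g assume "g \<in> carrier G"
    then obtain e u v where g: "g = w e u v" using gen by blast
    obtain e' u' v' where "(e', u', v') \<in> T" "w (e - e') (u - u') (v - v') = \<one>"
      using T(2)[unfolded K.represents_def, rule_format, of e u v] by blast
    then show "g \<in> (\<lambda>(e, u, v). w e u v) ` T" unfolding g w_eq_iff[symmetric] by force
  qed
  then have "card (carrier G) \<le> card ((\<lambda>(e, u, v). w e u v) ` T)" using T by (intro card_mono) auto
  also have "\<dots> \<le> card T" using T by (intro card_image_le)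
  finally show ?thesis by (simp add: order_def)
qed

lemma order_le_max_order:
  assumes "word_cover G i b1 b2 (int k)"
  shows "order G \<le> max_order k"
proof -
  obtain T q where T: "finite T" "K.represents T" "int (card T) \<le> 2 * q"
    and q: "3 * q \<le> (int k + 1)\<^sup>2 \<or> 4 * q \<le> (int k + 2)\<^sup>2"
    using K.represents_of_cover[OF covers_of_word_cover[OF assms]] .
  \<comment> \<open>As \<open>q\<close> is an integer, the bounds are rounded down before
    doubling.\<close>
  have "q \<le> (int k + 1)\<^sup>2 div 3 \<or> q \<le> (int k + 2)\<^sup>2 div 4" using q by linarith
  then have "q \<le> int (max ((k + 1)\<^sup>2 div 3) ((k + 2)\<^sup>2 div 4))"
    by (auto simp: of_nat_max zdiv_int add.commute)
  then have "card T \<le> max_order k" using T(3) unfolding max_order_def by linarith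
  moreover have "order G \<le> card T"
    using assms unfolding word_cover_def by (intro order_le_card T) blast
  ultimately show ?thesis by simp
qed

text \<open>A smaller diameter is impossible because the order exceeds its bound. The inequations
  \<open>nondeg\<close> make \<open>b1\<close> and \<open>b2\<close> distinct, different from
  \<open>i\<close>, and without inverses among the generators.\<close>

lemma attainsI:
  assumes k: "1 \<le> k" "word_cover G i b1 b2 (int k)" and N: "max_order (k - 1) < order G"
    and nondeg: "b1 \<otimes> b1 \<noteq> \<one>" "b2 \<otimes> b2 \<noteq> \<one>" "b1 \<otimes> b2 \<noteq> \<one>" "b1 \<noteq> b2"
  shows "attains G i b1 b2 k (order G)"
proof -
  have ni: "b1 \<noteq> i" "b2 \<noteq> i" using nondeg invol by auto
  have n1: "b1 \<noteq> \<one>" "b2 \<noteq> \<one>" using nondeg by auto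
  have inv_i: "inv i = i" using invol by (simp add: inv_equality)
  have inv_b: "inv b1 \<notin> {i, b1, b2}" "inv b2 \<notin> {i, b1, b2}"
    using nondeg ni inv_i by (auto simp: m_comm) (metis closed inv_inv r_inv m_comm)+
  have ord_iff: "ord g = 2 \<longleftrightarrow> g \<noteq> \<one> \<and> g \<otimes> g = \<one>" if "g \<in> carrier G" for g
  proof
    assume "ord g = 2"
    then show "g \<noteq> \<one> \<and> g \<otimes> g = \<one>" using pow_ord_eq_1[OF that] that
      by (auto simp: numeral_2_eq_2)
  next
    assume *: "g \<noteq> \<one> \<and> g \<otimes> g = \<one>"
    then have "g [^] (2::nat) = \<one>" using that by (simp add: numeral_2_eq_2)
    then have "ord g dvd 2" using that pow_eq_id by blast
    moreover have "ord g \<noteq> 1" using * ord_eq_1 that by blast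
    ultimately show "ord g = 2" using primes_dvd_imp_eq by (metis prime_nat_iff two_is_prime_nat)
  qed
  have "generate G {i, b1, b2} = carrier G"
  proof
    show "generate G {i, b1, b2} \<subseteq> carrier G" by (rule generate_incl) auto
    have sub: "subgroup (generate G {i, b1, b2}) G" by (rule generate_is_subgroup) auto
    have in_gen: "w e m n \<in> generate G {i, b1, b2}" for e m n
      unfolding word_def
      by (intro subgroup.m_closed[OF sub] subgroup_int_pow_closed[OF sub] generate.incl) auto
    show "carrier G \<subseteq> generate G {i, b1, b2}"
    proof
      fix g assume "g \<in> carrier G"
      then obtain e m n where "g = w e m n" using k(2) unfolding word_cover_def by blast
      then show "g \<in> generate G {i, b1, b2}" by (simp add: in_gen)
    qed
  qed
  moreover have "{a \<in> {i, b1, b2}. ord a = 2} = {i}"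
    using nondeg invol i_neq_one by (auto simp: ord_iff)
  moreover have "{a \<in> {i, b1, b2}. inv a \<in> {i, b1, b2} \<and> inv a \<noteq> a} = {}"
    using inv_b inv_i by auto
  moreover have "{b \<in> {i, b1, b2}. inv b \<notin> {i, b1, b2}} = {b1, b2}"
    using inv_b inv_i by auto
  moreover have "digraph_diameter cay = ereal (real k)"
  proof (rule diameter_eq[OF k(2,1)])
    show "\<not> word_cover G i b1 b2 (int k - 1)"
      using order_le_max_order[of "k - 1"] N k(1) by (auto simp: of_nat_diff)
  qed
  ultimately show ?thesis
    unfolding attains_def mixed_abelian_cayley_diam_def mixed_abelian_cayley_def
    using n1 nondeg i_neq_one finite_carrier invol comm_group_axioms by (simp add: ord_iff)
qed

lemma attains_of_relations:
  fixes p q h' h :: int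
  assumes gen: "\<And>g. g \<in> carrier G \<Longrightarrow> \<exists>e u v. g = w e u v"
    and rel: "w e1 p q = \<one>" "w e2 (- h') h = \<one>"
    and shape: "admissible_L_shape k (order G) p q h' h"
  shows "attains G i b1 b2 k (order G)"
proof -
  have pq: "0 \<le> p" "0 \<le> q" "0 < p + q" "w e1 p q = \<one>"
    and h: "0 \<le> h'" "h' < h" "w e2 (- h') h = \<one>"
    and l: "q \<le> h" "h < p + q + h'"
    and k: "p + q + h' \<le> int k + 1" "p + h \<le> int k + 1" "1 \<le> k"
    and N: "max_order (k - 1) < order G" "4 * k < order G"
    using rel shape by (simp_all add: admissible_L_shape_def)
  have pow: "g [^] int (order G) = \<one>" if "g \<in> carrier G" for g
    using that by (simp add: int_pow_int pow_order_eq_1)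
  \<comment> \<open>The power \<open>order G\<close> of every element is trivial, which gives the
    periods on both axes.\<close>
  have qc: "K.quotient_covers (int k - 1)"
    by (rule K.quotient_covers_of_relations[OF pq h l, where M = "int (order G)"])
      (use k N in \<open>auto simp: word_def pow\<close>)
  have short: "\<not> (w 0 2 0 = \<one> \<or> w 0 0 2 = \<one> \<or> w 0 1 1 = \<one> \<or> w 0 1 (- 1) = \<one>)"
  proof
    assume "w 0 2 0 = \<one> \<or> w 0 0 2 = \<one> \<or> w 0 1 1 = \<one> \<or> w 0 1 (- 1) = \<one>"
    from K.represents_of_short_relation[OF qc this] obtain T where
      T: "finite T" "K.represents T" "int (card T) \<le> 4 * int k" .
    from order_le_card[OF gen T(1,2)] T(3) N(2) show False by linarith
  qed
  have "b1 \<otimes> b1 \<noteq> \<one>" "b2 \<otimes> b2 \<noteq> \<one>" "b1 \<otimes> b2 \<noteq> \<one>" "b1 \<noteq> b2"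
    using short w_add[of 0 0 1 1 0 0] w_add[of 0 0 0 0 1 1] w_add[of 0 0 1 0 0 1] w_diff[of 0 0 1 0 0 1]
    by (auto simp: w_generators)
  then show ?thesis
    using word_cover_of_covers[OF gen K.covers_of_quotient_covers[OF qc]] k N
    by (intro attainsI) auto
qed

end

text \<open>With \<open>r2 = 0\<close>, a generator whose inverse is a generator equals its inverse
  and so is the only involution; the others are the two counted by \<open>z\<close>.\<close>

lemma involution_pairI:
  fixes G (structure)
  assumes "mixed_abelian_cayley G S 1 0 2"
  obtains i b1 b2 where "S = {i, b1, b2}" "involution_pair G i b1 b2"
proof -
  interpret comm_group G using assms by (simp add: mixed_abelian_cayley_def)
  have fin: "finite (carrier G)" and S: "S \<subseteq> carrier G - {\<one>}"
    and c1: "card {a \<in> S. ord a = 2} = 1"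
    and c2: "card {a \<in> S. inv a \<in> S \<and> inv a \<noteq> a} = 0"
    and c3: "card {b \<in> S. inv b \<notin> S} = 2"
    using assms by (auto simp: mixed_abelian_cayley_def)
  have finS: "finite S" using S fin by (meson finite_Diff finite_subset)
  obtain i where i: "{a \<in> S. ord a = 2} = {i}" using c1 by (rule card_1_singletonE)
  obtain b1 b2 where b: "{b \<in> S. inv b \<notin> S} = {b1, b2}" using c3 by (auto simp: card_2_iff)
  have c2': "{a \<in> S. inv a \<in> S \<and> inv a \<noteq> a} = {}" using c2 finS by simp
  have carr: "i \<in> carrier G" "b1 \<in> carrier G" "b2 \<in> carrier G" "i \<noteq> \<one>" "ord i = 2" using i b S by blast+
  have "a = i" if a: "a \<in> S" "inv a = a" for a
  proof -
    have aG: "a \<in> carrier G" "a \<noteq> \<one>" using a S by auto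
    have "a \<otimes> a = \<one>" using r_inv[OF aG(1)] a by simp
    then have "ord a dvd 2" using aG pow_eq_id[OF aG(1), of 2] by (simp add: numeral_2_eq_2)
    moreover have "ord a \<noteq> 1" using aG ord_eq_1 by blast
    ultimately have "ord a = 2" by (metis prime_nat_iff two_is_prime_nat)
    with a i show ?thesis by blast
  qed
  then have "S \<subseteq> {i, b1, b2}" using b c2' by blast
  moreover have "{i, b1, b2} \<subseteq> S" using i b by blast
  moreover have "i \<otimes> i = \<one>" using pow_ord_eq_1[OF carr(1)] carr by (simp add: numeral_2_eq_2)
  then have "involution_pair G i b1 b2" using carr fin by unfold_locales auto
  ultimately show ?thesis using that by blast
qed

lemma order_le_max_order_of_diam:
  assumes "mixed_abelian_cayley_diam G S 1 0 2 k"
  shows "order G \<le> max_order k"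
proof -
  obtain i b1 b2 where S: "S = {i, b1, b2}" and "involution_pair G i b1 b2"
    using assms involution_pairI unfolding mixed_abelian_cayley_diam_def by blast
  interpret involution_pair G i b1 b2 by fact
  show ?thesis
    using assms diameter_le_iff[of k] unfolding mixed_abelian_cayley_diam_def S
    by (intro order_le_max_order) simp
qed

section \<open>Products of cyclic groups\<close>

lemma word_Zmod: "word (Zmod n) i b1 b2 e u v = (e * i + u * b1 + v * b2) mod int n"
  by (simp add: word_def int_pow_integer_mod_group mod_simps)

lemma int_pow_DirProd:
  assumes "group G" "group H" "g \<in> carrier G" "h \<in> carrier H"
  shows "(g, h) [^]\<^bsub>G \<times>\<times> H\<^esub> (z::int) = (g [^]\<^bsub>G\<^esub> z, h [^]\<^bsub>H\<^esub> z)"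
proof -
  interpret GH: group "G \<times>\<times> H" using assms by (intro DirProd_group)
  have "fst \<in> hom (G \<times>\<times> H) G" "snd \<in> hom (G \<times>\<times> H) H" by (auto simp: hom_def)
  then have "fst ((g, h) [^]\<^bsub>G \<times>\<times> H\<^esub> z) = g [^]\<^bsub>G\<^esub> z" "snd ((g, h) [^]\<^bsub>G \<times>\<times> H\<^esub> z) = h [^]\<^bsub>H\<^esub> z"
    using hom_int_pow[of fst "G \<times>\<times> H" G "(g, h)" z] hom_int_pow[of snd "G \<times>\<times> H" H "(g, h)" z]
      assms GH.is_group by auto
  then show ?thesis by (metis prod.collapse)
qed

lemma word_DirProd:
  assumes "group G" "group H" "{i, b1, b2} \<subseteq> carrier G" "{i', b1', b2'} \<subseteq> carrier H"
  shows "word (G \<times>\<times> H) (i, i') (b1, b1') (b2, b2') e u v = (word G i b1 b2 e u v, word H i' b1' b2' e u v)"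
  using assms by (simp add: word_def int_pow_DirProd)

lemma comm_group_DirProd:
  assumes "comm_group G" "comm_group H"
  shows "comm_group (G \<times>\<times> H)"
proof -
  interpret G: comm_group G by fact
  interpret H: comm_group H by fact
  show ?thesis
    by (rule group.group_comm_groupI[OF DirProd_group])
      (auto simp: G.is_group H.is_group G.m_comm H.m_comm)
qed

lemma order_DirProd: "order (G \<times>\<times> H) = order G * order H"
  by (simp add: order_def card_cartesian_product)

lemma order_Zmod: "0 < n \<Longrightarrow> order (Zmod n) = n"
  by (simp add: order_def carrier_integer_mod_group)

lemma in_Zmod_iff: "0 < n \<Longrightarrow> x \<in> carrier (Zmod n) \<longleftrightarrow> 0 \<le> x \<and> x < int n"
  by (simp add: carrier_integer_mod_group)

lemma finite_Zmod: "0 < n \<Longrightarrow> finite (carrier (Zmod n))"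
  by (simp add: carrier_integer_mod_group)

lemma word_res1: "word (Zmod n) (res1 n i) (res1 n b1) (res1 n b2) e u v = (e * i + u * b1 + v * b2) mod int n"
  unfolding word_Zmod by (intro mod_add_cong) (simp_all add: mod_mult_right_eq)

lemma involution_pair_Zmod:
  assumes "N = 2 * M" "0 < M"
  shows "involution_pair (Zmod N) (res1 N (int M)) (res1 N c1) (res1 N c2)"
proof -
  interpret comm_group "Zmod N" by simp
  show ?thesis
    using assms by unfold_locales (auto simp: in_Zmod_iff finite_Zmod mod_simps)
qed

text \<open>The quotient by the involution \<open>M\<close> is cyclic of order \<open>M\<close>, so
  the relations are stated modulo \<open>M\<close>; the cofactors \<open>d1\<close>,
  \<open>d2\<close> become exponents of the involution. The Bezout identity \<open>gen\<close> makes
  \<open>1\<close> a word.\<close>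

lemma attains_Zmod:
  fixes c1 c2 e u v :: int
  assumes N: "N = 2 * M" "0 < M"
    and gen: "e * int M + u * c1 + v * c2 = 1"
    and rel: "int M dvd p * c1 + q * c2" "int M dvd h * c2 - h' * c1"
    and shape: "admissible_L_shape k N p q h' h"
  shows "attains (Zmod N) (res1 N (int M)) (res1 N c1) (res1 N c2) k N"
proof -
  interpret involution_pair "Zmod N" "res1 N (int M)" "res1 N c1" "res1 N c2"
    using N by (rule involution_pair_Zmod)
  have ord: "order (Zmod N) = N" using N by (simp add: order_Zmod)
  have gen': "\<exists>e u v. g = w e u v" if "g \<in> carrier (Zmod N)" for g
  proof -
    have "g * e * int M + g * u * c1 + g * v * c2 = g * (e * int M + u * c1 + v * c2)"
      by (simp add: algebra_simps)
    then have "w (g * e) (g * u) (g * v) = g mod int N"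
      unfolding word_res1 gen by simp
    also have "\<dots> = g" using that N by (simp add: in_Zmod_iff)
    finally show ?thesis by metis
  qed
  from rel(1) obtain d1 where "p * c1 + q * c2 = int M * d1" ..
  then have r1: "w (- d1) p q = \<one>\<^bsub>Zmod N\<^esub>" by (simp add: word_res1 algebra_simps)
  from rel(2) obtain d2 where "h * c2 - h' * c1 = int M * d2" ..
  then have "- d2 * int M + - h' * c1 + h * c2 = 0" by (simp add: algebra_simps)
  then have r2: "w (- d2) (- h') h = \<one>\<^bsub>Zmod N\<^esub>" by (simp add: word_res1)
  have "admissible_L_shape k (order (Zmod N)) p q h' h" using shape by (simp only: ord)
  from attains_of_relations[OF gen' r1 r2 this] show ?thesis by (simp only: ord)
qed

lemma word_res2:
  assumes "0 < m" "0 < n"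
  shows "word (Zmod m \<times>\<times> Zmod n) (res2 m n i i') (res2 m n b1 b1') (res2 m n b2 b2') e u v =
    res2 m n (e * i + u * b1 + v * b2) (e * i' + u * b1' + v * b2')"
  using assms by (subst word_DirProd) (auto simp: in_Zmod_iff word_res1)

lemma involution_pair_Zmod2:
  assumes "0 < m" "0 < n" "int m dvd 2 * i" "int n dvd 2 * i'" "\<not> (int m dvd i \<and> int n dvd i')"
  shows "involution_pair (Zmod m \<times>\<times> Zmod n) (res2 m n i i') (res2 m n b1 b1') (res2 m n b2 b2')"
proof -
  interpret comm_group "Zmod m \<times>\<times> Zmod n" by (intro comm_group_DirProd) simp_all
  have "(i mod int m + i mod int m) mod int m = 0" "(i' mod int n + i' mod int n) mod int n = 0"
    using assms(3,4) by (simp_all only: mod_add_eq mult_2 dvd_eq_mod_eq_0)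
  then have "res2 m n i i' \<otimes>\<^bsub>Zmod m \<times>\<times> Zmod n\<^esub> res2 m n i i' = \<one>\<^bsub>Zmod m \<times>\<times> Zmod n\<^esub>"
    by simp
  moreover have "res2 m n i i' \<noteq> \<one>\<^bsub>Zmod m \<times>\<times> Zmod n\<^esub>"
    using assms(5) by (simp add: dvd_eq_mod_eq_0)
  ultimately show ?thesis
    using assms(1,2) by unfold_locales (simp_all add: in_Zmod_iff finite_Zmod)
qed

lemma attains_Zmod2:
  fixes i i' b1 b1' b2 b2' :: int
  assumes mn: "0 < m" "0 < n"
    and i: "int m dvd 2 * i" "int n dvd 2 * i'" "\<not> (int m dvd i \<and> int n dvd i')"
    and gen: "\<And>x y. \<exists>e u v. int m dvd x - (e * i + u * b1 + v * b2) \<and> int n dvd y - (e * i' + u * b1' + v * b2')"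
    and rel: "int m dvd e1 * i + p * b1 + q * b2" "int n dvd e1 * i' + p * b1' + q * b2'"
      "int m dvd e2 * i + - h' * b1 + h * b2" "int n dvd e2 * i' + - h' * b1' + h * b2'"
    and shape: "admissible_L_shape k (m * n) p q h' h"
  shows "attains (Zmod m \<times>\<times> Zmod n) (res2 m n i i') (res2 m n b1 b1') (res2 m n b2 b2') k (m * n)"
proof -
  interpret involution_pair "Zmod m \<times>\<times> Zmod n" "res2 m n i i'" "res2 m n b1 b1'" "res2 m n b2 b2'"
    using mn i by (rule involution_pair_Zmod2)
  have ord: "order (Zmod m \<times>\<times> Zmod n) = m * n" using mn by (simp add: order_DirProd order_Zmod)
  have gen': "\<exists>e u v. g = w e u v" if carr: "g \<in> carrier (Zmod m \<times>\<times> Zmod n)" for g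
  proof -
    obtain x y where g: "g = (x, y)" "x mod int m = x" "y mod int n = y"
      using mn carr by (cases g) (auto simp: in_Zmod_iff)
    obtain e u v where "int m dvd x - (e * i + u * b1 + v * b2)" "int n dvd y - (e * i' + u * b1' + v * b2')"
      using gen[of x y] by blast
    then have "g = w e u v" using g by (simp add: word_res2[OF mn] mod_eq_dvd_iff[symmetric])
    then show ?thesis by blast
  qed
  have r: "w e1 p q = \<one>\<^bsub>Zmod m \<times>\<times> Zmod n\<^esub>" "w e2 (- h') h = \<one>\<^bsub>Zmod m \<times>\<times> Zmod n\<^esub>"
    using rel by (simp_all add: word_res2[OF mn])
  have "admissible_L_shape k (order (Zmod m \<times>\<times> Zmod n)) p q h' h" using shape by (simp only: ord)
  from attains_of_relations[OF gen' r this] show ?thesis by (simp only: ord)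
qed

lemma word_res3:
  assumes "0 < l" "0 < m" "0 < n"
  shows "word (Zmod l \<times>\<times> Zmod m \<times>\<times> Zmod n) (res3 l m n i i' i'') (res3 l m n b1 b1' b1'') (res3 l m n b2 b2' b2'') e u v =
    res3 l m n (e * i + u * b1 + v * b2) (e * i' + u * b1' + v * b2') (e * i'' + u * b1'' + v * b2'')"
proof -
  have "word (Zmod l \<times>\<times> Zmod m \<times>\<times> Zmod n) (res3 l m n i i' i'') (res3 l m n b1 b1' b1'') (res3 l m n b2 b2' b2'') e u v =
    (word (Zmod l) (res1 l i) (res1 l b1) (res1 l b2) e u v,
     word (Zmod m \<times>\<times> Zmod n) (res2 m n i' i'') (res2 m n b1' b1'') (res2 m n b2' b2'') e u v)"
    using assms by (intro word_DirProd) (simp_all add: in_Zmod_iff DirProd_group)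
  then show ?thesis unfolding word_res1 word_res2[OF assms(2,3)] .
qed

section \<open>Extremal graphs\<close>

text \<open>The shape has area \<open>3 * x\<^sup>2\<close>, half the order, and both degree bounds
  hold with equality. The shapes for the other residues of \<open>k\<close> modulo 3 lengthen some
  sides by one.\<close>

lemma admissible_L_shape_3x_minus_1:
  assumes "1 < x"
  shows "admissible_L_shape (3 * x - 1) (6 * x\<^sup>2) (int x) (int x) (int x) (2 * int x)"
proof -
  \<comment> \<open>With \<open>x = y + 2\<close> the truncated subtractions disappear and the
    inequalities hold coefficientwise in \<open>y\<close>.\<close>
  obtain y where y: "x = y + 2" using assms by (intro that[of "x - 2"]) simp
  have "(3 * x - 1 - 1 + 1)\<^sup>2 div 3 < 3 * x\<^sup>2" "(3 * x - 1 - 1 + 2)\<^sup>2 div 4 < 3 * x\<^sup>2"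
    unfolding y by (intro less_mult_imp_div_less; simp add: power2_eq_square algebra_simps)+
  then have "max_order (3 * x - 1 - 1) < 6 * x\<^sup>2" unfolding max_order_def by linarith
  moreover have "4 * (3 * x - 1) < 6 * x\<^sup>2" unfolding y by (simp add: power2_eq_square algebra_simps)
  ultimately show ?thesis using assms by (simp add: admissible_L_shape_def of_nat_diff)
qed

lemma admissible_L_shape_3x:
  assumes "1 < x"
  shows "admissible_L_shape (3 * x) (6 * x\<^sup>2 + 4 * x) (int x) (int x + 1) (int x) (2 * int x + 1)"
proof -
  obtain y where y: "x = y + 2" using assms by (intro that[of "x - 2"]) simp
  have "(3 * x - 1 + 1)\<^sup>2 div 3 < 3 * x\<^sup>2 + 2 * x" "(3 * x - 1 + 2)\<^sup>2 div 4 < 3 * x\<^sup>2 + 2 * x"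
    unfolding y by (intro less_mult_imp_div_less; simp add: power2_eq_square algebra_simps)+
  then have "max_order (3 * x - 1) < 6 * x\<^sup>2 + 4 * x" unfolding max_order_def by linarith
  moreover have "4 * (3 * x) < 6 * x\<^sup>2 + 4 * x" unfolding y by (simp add: power2_eq_square algebra_simps)
  ultimately show ?thesis using assms by (simp add: admissible_L_shape_def)
qed

lemma admissible_L_shape_3x_plus_1:
  assumes "1 < x"
  shows "admissible_L_shape (3 * x + 1) (6 * x\<^sup>2 + 8 * x + 2) (int x + 1) (int x + 1) (int x) (2 * int x + 1)"
proof -
  obtain y where y: "x = y + 2" using assms by (intro that[of "x - 2"]) simp
  have "(3 * x + 1 - 1 + 1)\<^sup>2 div 3 < 3 * x\<^sup>2 + 4 * x + 1" "(3 * x + 1 - 1 + 2)\<^sup>2 div 4 < 3 * x\<^sup>2 + 4 * x + 1"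
    unfolding y by (intro less_mult_imp_div_less; simp add: power2_eq_square algebra_simps)+
  then have "max_order (3 * x + 1 - 1) < 6 * x\<^sup>2 + 8 * x + 2" unfolding max_order_def by linarith
  moreover have "4 * (3 * x + 1) < 6 * x\<^sup>2 + 8 * x + 2" unfolding y by (simp add: power2_eq_square algebra_simps)
  ultimately show ?thesis using assms by (simp add: admissible_L_shape_def)
qed

section \<open>Closed forms of the order bound\<close>

lemma max_order_3x_minus_1:
  assumes "1 < x"
  shows "max_order (3 * x - 1) = 6 * x\<^sup>2"
proof -
  obtain y where y: "x = y + 2" using assms by (intro that[of "x - 2"]) simp
  have "(3 * x - 1 + 1)\<^sup>2 div 3 = 3 * x\<^sup>2"
    unfolding y by (rule div_nat_eqI) (simp_all add: power2_eq_square algebra_simps)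
  \<comment> \<open>Multiplied by four this is \<open>3 * (x - 1)\<^sup>2 > 0\<close>; it fails for
    \<open>x = 1\<close>, that is for \<open>k = 2\<close>.\<close>
  moreover have "(3 * x - 1 + 2)\<^sup>2 div 4 < 3 * x\<^sup>2 + 1"
    unfolding y by (intro less_mult_imp_div_less) (simp add: power2_eq_square algebra_simps)
  ultimately show ?thesis unfolding max_order_def by simp
qed

lemma max_order_3x:
  assumes "1 < x"
  shows "max_order (3 * x) = 6 * x\<^sup>2 + 4 * x"
proof -
  obtain y where y: "x = y + 2" using assms by (intro that[of "x - 2"]) simp
  have "(3 * x + 1)\<^sup>2 div 3 = 3 * x\<^sup>2 + 2 * x"
    by (rule div_nat_eqI) (simp_all add: power2_eq_square algebra_simps)
  moreover have "(3 * x + 2)\<^sup>2 div 4 < 3 * x\<^sup>2 + 2 * x + 1"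
    unfolding y by (intro less_mult_imp_div_less) (simp add: power2_eq_square algebra_simps)
  ultimately show ?thesis unfolding max_order_def by simp
qed

lemma max_order_3x_plus_1:
  assumes "1 < x"
  shows "max_order (3 * x + 1) = 6 * x\<^sup>2 + 8 * x + 2"
proof -
  obtain y where y: "x = y + 2" using assms by (intro that[of "x - 2"]) simp
  have "(3 * x + 1 + 1)\<^sup>2 div 3 = 3 * x\<^sup>2 + 4 * x + 1"
    by (rule div_nat_eqI) (simp_all add: power2_eq_square algebra_simps)
  moreover have "(3 * x + 1 + 2)\<^sup>2 div 4 < 3 * x\<^sup>2 + 4 * x + 2"
    unfolding y by (intro less_mult_imp_div_less) (simp add: power2_eq_square algebra_simps)
  ultimately show ?thesis unfolding max_order_def by simp
qed

text \<open>For \<open>k = 2, 3, 4\<close> the extremal order exceeds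
  \<open>2 (k + 1)\<^sup>2 / 3\<close>, so no L-shape can serve; the finite ranges allow
  \<open>cover\<close> to be checked by evaluation.\<close>

lemma attains_of_enumeration:
  fixes M k N :: nat and c1 c2 :: int
  assumes N: "N = 2 * M" "0 < M"
    and cover: "\<forall>g\<in>set [0..int N - 1]. \<exists>e\<in>{0, 1}. \<exists>m\<in>set [0..int k]. \<exists>n\<in>set [0..int k].
      e + m + n \<le> int k \<and> g = (e * int M + m * c1 + n * c2) mod int N"
    and k: "1 \<le> k" "max_order (k - 1) < N"
    and nondeg: "(c1 + c1) mod int N \<noteq> 0" "(c2 + c2) mod int N \<noteq> 0"
      "(c1 + c2) mod int N \<noteq> 0" "c1 mod int N \<noteq> c2 mod int N"
  shows "attains (Zmod N) (res1 N (int M)) (res1 N c1) (res1 N c2) k N"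
proof -
  interpret involution_pair "Zmod N" "res1 N (int M)" "res1 N c1" "res1 N c2"
    using N by (rule involution_pair_Zmod)
  have ord: "order (Zmod N) = N" using N by (simp add: order_Zmod)
  have "word_cover (Zmod N) (res1 N (int M)) (res1 N c1) (res1 N c2) (int k)"
    unfolding word_cover_def
  proof
    fix g assume "g \<in> carrier (Zmod N)"
    then have "g \<in> set [0..int N - 1]" using N by (simp add: in_Zmod_iff)
    from bspec[OF cover this] obtain e m n where
      "e \<in> {0, 1}" "m \<in> set [0..int k]" "n \<in> set [0..int k]"
      "e + m + n \<le> int k" "g = (e * int M + m * c1 + n * c2) mod int N"
      by (elim bexE conjE)
    then show "\<exists>e m n. 0 \<le> e \<and> e \<le> 1 \<and> 0 \<le> m \<and> 0 \<le> n \<and> e + m + n \<le> int k \<and> g = w e m n"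
      by (intro exI[of _ e] exI[of _ m] exI[of _ n]) (auto simp: word_res1)
  qed
  then have "attains (Zmod N) (res1 N (int M)) (res1 N c1) (res1 N c2) k (order (Zmod N))"
    using k nondeg
    by (intro attainsI) (simp_all add: mod_add_eq mod_mult_right_eq ord)
  then show ?thesis unfolding ord .
qed

section \<open>The infinite families\<close>

lemma attains_3x_minus_1_even:
  assumes "1 < x" "even x"
  shows "attains (Zmod 2 \<times>\<times> Zmod x \<times>\<times> Zmod (3 * x))
    (res3 2 x (3 * x) 1 0 0) (res3 2 x (3 * x) 1 1 1) (res3 2 x (3 * x) 1 3 2) (3 * x - 1) (6 * x\<^sup>2)"
proof -
  let ?G = "Zmod 2 \<times>\<times> Zmod x \<times>\<times> Zmod (3 * x)"
  have x: "0 < x" using assms by simp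
  interpret comm_group ?G by (intro comm_group_DirProd) simp_all
  interpret involution_pair ?G "res3 2 x (3 * x) 1 0 0" "res3 2 x (3 * x) 1 1 1" "res3 2 x (3 * x) 1 3 2"
    using x by unfold_locales (simp_all add: in_Zmod_iff finite_Zmod)
  have word: "w e u v = res3 2 x (3 * x) (e * 1 + u * 1 + v * 1) (e * 0 + u * 1 + v * 3) (e * 0 + u * 1 + v * 2)"
    for e u v using word_res3[of 2 x "3 * x" 1 0 0 1 1 1 1 3 2 e u v] x by simp
  have ord: "order ?G = 6 * x\<^sup>2" using x by (simp add: order_DirProd order_Zmod power2_eq_square)
  have gen: "\<exists>e u v. g = w e u v" if carr: "g \<in> carrier ?G" for g
  proof -
    obtain a b c where g: "g = (a, b, c)" "a mod 2 = a" "b mod int x = b" "c mod int (3 * x) = c"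
      using x carr by (cases g) (auto simp: in_Zmod_iff)
    \<comment> \<open>The system \<open>u + 3 v = b\<close>, \<open>u + 2 v = c\<close> has
      determinant \<open>- 1\<close>; the involution then adjusts the first coordinate.\<close>
    have "g = w (a - 2 * c + b) (3 * c - 2 * b) (b - c)" unfolding word using g by simp
    then show ?thesis by blast
  qed
  \<comment> \<open>The first coordinate of the second relation is \<open>x\<close> modulo 2, which
    vanishes for even \<open>x\<close>.\<close>
  have r: "w 0 (int x) (int x) = \<one>\<^bsub>?G\<^esub>" "w 0 (- int x) (2 * int x) = \<one>\<^bsub>?G\<^esub>"
    using assms(2) unfolding word by (simp_all add: mod_0_imp_dvd dvd_imp_mod_0)
  have "admissible_L_shape (3 * x - 1) (order ?G) (int x) (int x) (int x) (2 * int x)"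
    unfolding ord by (rule admissible_L_shape_3x_minus_1[OF assms(1)])
  from attains_of_relations[OF gen r this] show ?thesis by (simp only: ord)
qed

lemma attains_3x_minus_1_odd:
  assumes "1 < x" "odd x"
  shows "attains (Zmod x \<times>\<times> Zmod (6 * x))
    (res2 x (6 * x) 0 (3 * int x)) (res2 x (6 * x) 1 (- 2))
    (res2 x (6 * x) (3 - int x) (3 * int x - 7)) (3 * x - 1) (6 * x\<^sup>2)"
proof -
  have N: "x * (6 * x) = 6 * x\<^sup>2" by (simp add: power2_eq_square)
  obtain t where t: "int x = 2 * t + 1" using assms(2) by (metis even_of_nat oddE)
  show ?thesis
    unfolding N[symmetric]
  proof (rule attains_Zmod2[where ?e1.0 = 0 and ?e2.0 = 0])
    fix a b :: int
    \<comment> \<open>The exponents of the involution and of the second generator are opposite, so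
      their multiples of \<open>3 x\<close> cancel in the second coordinate.\<close>
    have "int x dvd a - ((b + 2 * a) * 0 + (7 * a + 3 * b) * 1 + - (b + 2 * a) * (3 - int x))"
      by (rule dvdI[of _ _ "- (b + 2 * a)"]) (simp add: algebra_simps)
    moreover have "int (6 * x) dvd b - ((b + 2 * a) * (3 * int x) + (7 * a + 3 * b) * - 2 + - (b + 2 * a) * (3 * int x - 7))"
      by (rule dvdI[of _ _ 0]) (simp add: algebra_simps)
    ultimately show "\<exists>e u v. int x dvd a - (e * 0 + u * 1 + v * (3 - int x)) \<and>
        int (6 * x) dvd b - (e * (3 * int x) + u * - 2 + v * (3 * int x - 7))" by blast
  next
    show "int x dvd 0 * 0 + int x * 1 + int x * (3 - int x)" by simp
    \<comment> \<open>The dividend is \<open>3 x (x - 3)\<close>, and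
      \<open>x - 3 = 2 (t - 1)\<close>.\<close>
    show "int (6 * x) dvd 0 * (3 * int x) + int x * - 2 + int x * (3 * int x - 7)"
      by (rule dvdI[of _ _ "t - 1"]) (simp add: t algebra_simps)
    show "int x dvd 0 * 0 + - int x * 1 + (2 * int x) * (3 - int x)" by simp
    show "int (6 * x) dvd 0 * (3 * int x) + - int x * - 2 + (2 * int x) * (3 * int x - 7)"
      by (rule dvdI[of _ _ "int x - 2"]) (simp add: algebra_simps)
    show "admissible_L_shape (3 * x - 1) (x * (6 * x)) (int x) (int x) (int x) (2 * int x)"
      unfolding N by (rule admissible_L_shape_3x_minus_1[OF assms(1)])
    show "\<not> (int x dvd 0 \<and> int (6 * x) dvd 3 * int x)"
      using zdvd_imp_le[of "int (6 * x)" "3 * int x"] assms(1) by auto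
  qed (use assms in auto)
qed

lemma attains_3x_minus_1:
  assumes "1 < x"
  shows "attains (Zmod x \<times>\<times> Zmod (6 * x))
    (res2 x (6 * x) 0 (3 * int x)) (res2 x (6 * x) 3 2) (res2 x (6 * x) 1 1) (3 * x - 1) (6 * x\<^sup>2)"
proof -
  have N: "x * (6 * x) = 6 * x\<^sup>2" by (simp add: power2_eq_square)
  show ?thesis
    unfolding N[symmetric]
  \<comment> \<open>Here \<open>x (b\<^sub>1 + b\<^sub>2) = (4 x, 3 x)\<close> is the involution
    itself, hence \<open>e1 = 1\<close>.\<close>
  proof (rule attains_Zmod2[where ?e1.0 = 1 and ?e2.0 = 0])
    fix a b :: int
    show "\<exists>e u v. int x dvd a - (e * 0 + u * 3 + v * 1) \<and>
        int (6 * x) dvd b - (e * (3 * int x) + u * 2 + v * 1)"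
      by (intro exI[of _ 0] exI[of _ "a - b"] exI[of _ "3 * b - 2 * a"]) simp
  next
    show "admissible_L_shape (3 * x - 1) (x * (6 * x)) (int x) (int x) (int x) (2 * int x)"
      unfolding N by (rule admissible_L_shape_3x_minus_1[OF assms(1)])
    show "\<not> (int x dvd 0 \<and> int (6 * x) dvd 3 * int x)"
      using zdvd_imp_le[of "int (6 * x)" "3 * int x"] assms(1) by auto
  qed (use assms in auto)
qed

text \<open>The involution \<open>(1, 0)\<close> corrects the first coordinate, so the relations are
  those of \<open>1\<close> and \<open>c\<close> in \<open>Zmod M\<close>.\<close>

lemma attains_Z2_Zmod:
  assumes "0 < M" and rel: "int M dvd p + q * c" "int M dvd h * c - h'"
    and shape: "admissible_L_shape k (2 * M) p q h' h"
  shows "attains (Zmod 2 \<times>\<times> Zmod M) (res2 2 M 1 0) (res2 2 M 1 1) (res2 2 M c c) k (2 * M)"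
proof (rule attains_Zmod2[where ?e1.0 = "- (p + q * c)" and ?e2.0 = "h' - h * c"])
  fix a b :: int
  show "\<exists>e u v. int 2 dvd a - (e * 1 + u * 1 + v * c) \<and> int M dvd b - (e * 0 + u * 1 + v * c)"
    by (intro exI[of _ "a - b"] exI[of _ b] exI[of _ 0]) simp
qed (use assms in auto)

lemma attains_3x_even:
  assumes "1 < x" "N = 6 * x\<^sup>2 + 4 * x"
  shows "attains (Zmod 2 \<times>\<times> Zmod (N div 2))
    (res2 2 (N div 2) 1 0) (res2 2 (N div 2) 1 1) (res2 2 (N div 2) (- 3 * int x) (- 3 * int x)) (3 * x) N"
proof -
  define M where "M = 3 * x\<^sup>2 + 2 * x"
  have N: "N div 2 = M" "N = 2 * M" using assms(2) by (simp_all add: M_def)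
  show ?thesis
    unfolding N(1) unfolding N(2)
  proof (rule attains_Z2_Zmod)
    show "int M dvd int x + (int x + 1) * (- 3 * int x)"
      by (rule dvdI[of _ _ "- 1"]) (simp add: M_def power2_eq_square algebra_simps)
    show "int M dvd (2 * int x + 1) * (- 3 * int x) - int x"
      by (rule dvdI[of _ _ "- 2"]) (simp add: M_def power2_eq_square algebra_simps)
    show "admissible_L_shape (3 * x) (2 * M) (int x) (int x + 1) (int x) (2 * int x + 1)"
      using admissible_L_shape_3x[OF assms(1)] by (simp add: M_def)
  qed (use assms in \<open>simp add: M_def\<close>)
qed

text \<open>As \<open>3 x\<^sup>2 - x = M - 3 x\<close>, the generators modulo the involution are
  \<open>1\<close> and \<open>- 3 x\<close> in \<open>Zmod M\<close>.\<close>

lemma attains_3x_odd: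
  assumes "1 < x" "N = 6 * x\<^sup>2 + 4 * x"
  shows "attains (Zmod N)
    (res1 N (int N div 2)) (res1 N (int N div 2 + 1)) (res1 N (3 * int x ^ 2 - int x)) (3 * x) N"
proof -
  define M where "M = 3 * x\<^sup>2 + 2 * x"
  have N: "N = 2 * M" "int N div 2 = int M" using assms(2) by (simp_all add: M_def)
  show ?thesis
    unfolding N(2)
  proof (rule attains_Zmod[OF N(1)])
    show "int M dvd int x * (int M + 1) + (int x + 1) * (3 * int x ^ 2 - int x)"
      by (rule dvdI[of _ _ "2 * int x"]) (simp add: M_def power2_eq_square algebra_simps)
    show "int M dvd (2 * int x + 1) * (3 * int x ^ 2 - int x) - int x * (int M + 1)"
      by (rule dvdI[of _ _ "int x - 1"]) (simp add: M_def power2_eq_square algebra_simps)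
    show "admissible_L_shape (3 * x) N (int x) (int x + 1) (int x) (2 * int x + 1)"
      unfolding assms(2) by (rule admissible_L_shape_3x[OF assms(1)])
    show "- 1 * int M + 1 * (int M + 1) + 0 * (3 * int x ^ 2 - int x) = 1" by simp
  qed (use assms in \<open>simp add: M_def\<close>)
qed

text \<open>The relation \<open>(2 x + 1) b\<^sub>2 = x b\<^sub>1\<close> holds already over the
  integers, and \<open>x b\<^sub>1 + (x + 1) b\<^sub>2\<close> is the involution
  \<open>M\<close>.\<close>

lemma attains_3x:
  assumes "1 < x" "N = 6 * x\<^sup>2 + 4 * x"
  shows "attains (Zmod N) (res1 N (int N div 2)) (res1 N (2 * int x + 1)) (res1 N (int x)) (3 * x) N"
proof -
  define M where "M = 3 * x\<^sup>2 + 2 * x"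
  have N: "N = 2 * M" "int N div 2 = int M" using assms(2) by (simp_all add: M_def)
  show ?thesis
    unfolding N(2)
  proof (rule attains_Zmod[OF N(1)])
    show "int M dvd int x * (2 * int x + 1) + (int x + 1) * int x"
      by (rule dvdI[of _ _ 1]) (simp add: M_def power2_eq_square algebra_simps)
    show "int M dvd (2 * int x + 1) * int x - int x * (2 * int x + 1)" by simp
    show "admissible_L_shape (3 * x) N (int x) (int x + 1) (int x) (2 * int x + 1)"
      unfolding assms(2) by (rule admissible_L_shape_3x[OF assms(1)])
    show "0 * int M + 1 * (2 * int x + 1) + - 2 * int x = 1" by simp
  qed (use assms in \<open>simp add: M_def\<close>)
qed

text \<open>As \<open>6 x\<^sup>2 + 5 x = N - 3 x - 2\<close>, the generators modulo the involution
  are \<open>1\<close> and \<open>- 3 x - 2\<close>; the first relation is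
  \<open>M = (x + 1) (3 x + 1)\<close>.\<close>

lemma attains_3x_plus_1_even:
  assumes "1 < x" "N = 6 * x\<^sup>2 + 8 * x + 2"
  shows "attains (Zmod N)
    (res1 N (int N div 2)) (res1 N (int N div 2 + 1)) (res1 N (6 * int x ^ 2 + 5 * int x)) (3 * x + 1) N"
proof -
  define M where "M = 3 * x\<^sup>2 + 4 * x + 1"
  have N: "N = 2 * M" "int N div 2 = int M" using assms(2) by (simp_all add: M_def)
  show ?thesis
    unfolding N(2)
  proof (rule attains_Zmod[OF N(1)])
    show "int M dvd (int x + 1) * (int M + 1) + (int x + 1) * (6 * int x ^ 2 + 5 * int x)"
      by (rule dvdI[of _ _ "3 * int x + 2"]) (simp add: M_def power2_eq_square algebra_simps)
    show "int M dvd (2 * int x + 1) * (6 * int x ^ 2 + 5 * int x) - int x * (int M + 1)"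
      by (rule dvdI[of _ _ "3 * int x"]) (simp add: M_def power2_eq_square algebra_simps)
    show "admissible_L_shape (3 * x + 1) N (int x + 1) (int x + 1) (int x) (2 * int x + 1)"
      unfolding assms(2) by (rule admissible_L_shape_3x_plus_1[OF assms(1)])
    show "- 1 * int M + 1 * (int M + 1) + 0 * (6 * int x ^ 2 + 5 * int x) = 1" by simp
  qed (use assms in \<open>simp add: M_def\<close>)
qed

text \<open>This is the pair \<open>1\<close>, \<open>- 3 x - 2\<close> of \<open>Zmod M\<close> in
  the opposite order. The same shape fits because
  \<open>(2 x + 1) + x (3 x + 2) = M\<close>.\<close>

lemma attains_3x_plus_1_even':
  assumes "1 < x" "N = 6 * x\<^sup>2 + 8 * x + 2"
  shows "attains (Zmod N)
    (res1 N (int N div 2)) (res1 N (int N div 2 - 3 * int x - 2)) (res1 N (int N div 2 + 1)) (3 * x + 1) N"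
proof -
  define M where "M = 3 * x\<^sup>2 + 4 * x + 1"
  have N: "N = 2 * M" "int N div 2 = int M" using assms(2) by (simp_all add: M_def)
  show ?thesis
    unfolding N(2)
  proof (rule attains_Zmod[OF N(1)])
    show "int M dvd (int x + 1) * (int M - 3 * int x - 2) + (int x + 1) * (int M + 1)"
      by (rule dvdI[of _ _ "2 * int x + 1"]) (simp add: M_def power2_eq_square algebra_simps)
    show "int M dvd (2 * int x + 1) * (int M + 1) - int x * (int M - 3 * int x - 2)"
      by (rule dvdI[of _ _ "int x + 2"]) (simp add: M_def power2_eq_square algebra_simps)
    show "admissible_L_shape (3 * x + 1) N (int x + 1) (int x + 1) (int x) (2 * int x + 1)"
      unfolding assms(2) by (rule admissible_L_shape_3x_plus_1[OF assms(1)])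
    show "- 1 * int M + 0 * (int M - 3 * int x - 2) + 1 * (int M + 1) = 1" by simp
  qed (use assms in \<open>simp add: M_def\<close>)
qed

lemma attains_3x_plus_1_odd:
  assumes "1 < x" "N = 6 * x\<^sup>2 + 8 * x + 2"
  shows "attains (Zmod 2 \<times>\<times> Zmod (N div 2))
    (res2 2 (N div 2) 1 0) (res2 2 (N div 2) 1 1)
    (res2 2 (N div 2) (- 3 * int x - 2) (- 3 * int x - 2)) (3 * x + 1) N"
proof -
  define M where "M = 3 * x\<^sup>2 + 4 * x + 1"
  have N: "N div 2 = M" "N = 2 * M" using assms(2) by (simp_all add: M_def)
  show ?thesis
    unfolding N(1) unfolding N(2)
  proof (rule attains_Z2_Zmod)
    show "int M dvd int x + 1 + (int x + 1) * (- 3 * int x - 2)"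
      by (rule dvdI[of _ _ "- 1"]) (simp add: M_def power2_eq_square algebra_simps)
    show "int M dvd (2 * int x + 1) * (- 3 * int x - 2) - int x"
      by (rule dvdI[of _ _ "- 2"]) (simp add: M_def power2_eq_square algebra_simps)
    show "admissible_L_shape (3 * x + 1) (2 * M) (int x + 1) (int x + 1) (int x) (2 * int x + 1)"
      using admissible_L_shape_3x_plus_1[OF assms(1)] by (simp add: M_def)
  qed (use assms in \<open>simp add: M_def\<close>)
qed

lemma attains_3x_plus_1_odd':
  assumes "1 < x" "N = 6 * x\<^sup>2 + 8 * x + 2"
  shows "attains (Zmod N)
    (res1 N (int N div 2)) (res1 N (int N div 2 - 3 * int x - 2)) (res1 N 1) (3 * x + 1) N"
proof -
  define M where "M = 3 * x\<^sup>2 + 4 * x + 1"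
  have N: "N = 2 * M" "int N div 2 = int M" using assms(2) by (simp_all add: M_def)
  show ?thesis
    unfolding N(2)
  proof (rule attains_Zmod[OF N(1)])
    show "int M dvd (int x + 1) * (int M - 3 * int x - 2) + (int x + 1) * 1"
      by (rule dvdI[of _ _ "int x"]) (simp add: M_def power2_eq_square algebra_simps)
    show "int M dvd (2 * int x + 1) * 1 - int x * (int M - 3 * int x - 2)"
      by (rule dvdI[of _ _ "1 - int x"]) (simp add: M_def power2_eq_square algebra_simps)
    show "admissible_L_shape (3 * x + 1) N (int x + 1) (int x + 1) (int x) (2 * int x + 1)"
      unfolding assms(2) by (rule admissible_L_shape_3x_plus_1[OF assms(1)])
    show "0 * int M + 0 * (int M - 3 * int x - 2) + 1 * 1 = (1 :: int)" by simp
  qed (use assms in \<open>simp add: M_def\<close>)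
qed

lemma attains_8: "attains (Zmod 8) 4 1 3 2 8"
proof -
  have "\<forall>g\<in>set [0..int 8 - 1]. \<exists>e\<in>{0, 1}. \<exists>m\<in>set [0..int 2]. \<exists>n\<in>set [0..int 2].
      e + m + n \<le> int 2 \<and> g = (e * int 4 + m * 1 + n * 3) mod int 8" by code_simp
  from attains_of_enumeration[OF _ _ this] show ?thesis by (simp add: max_order_def power2_eq_square)
qed

lemma attains_12: "attains (Zmod 12) 6 1 4 3 12"
proof -
  have "\<forall>g\<in>set [0..int 12 - 1]. \<exists>e\<in>{0, 1}. \<exists>m\<in>set [0..int 3]. \<exists>n\<in>set [0..int 3].
      e + m + n \<le> int 3 \<and> g = (e * int 6 + m * 1 + n * 4) mod int 12" by code_simp
  from attains_of_enumeration[OF _ _ this] show ?thesis by (simp add: max_order_def power2_eq_square)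
qed

lemma attains_18: "attains (Zmod 18) 9 1 4 4 18"
proof -
  have "\<forall>g\<in>set [0..int 18 - 1]. \<exists>e\<in>{0, 1}. \<exists>m\<in>set [0..int 4]. \<exists>n\<in>set [0..int 4].
      e + m + n \<le> int 4 \<and> g = (e * int 9 + m * 1 + n * 4) mod int 18" by code_simp
  from attains_of_enumeration[OF _ _ this] show ?thesis by (simp add: max_order_def power2_eq_square)
qed

theorem theorem3p1:
  fixes k :: nat
  assumes "k \<ge> 2"
  shows
    "\<exists>N::nat.
      (\<forall>(G :: 'a monoid) S. mixed_abelian_cayley_diam G S 1 0 2 k \<longrightarrow> order G \<le> N) \<and>
      (k = 2 \<longrightarrow> N = 8 \<and> attains (Zmod 8) 4 1 3 k N) \<and>
      (k = 3 \<longrightarrow> N = 12 \<and> attains (Zmod 12) 6 1 4 k N) \<and>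
      (k = 4 \<longrightarrow> N = 18 \<and> attains (Zmod 18) 9 1 4 k N) \<and>
      (\<forall>x::nat. x > 1 \<and> k = 3 * x - 1 \<longrightarrow>
        N = 6 * x^2 \<and>
        (even x \<longrightarrow> attains (Zmod 2 \<times>\<times> Zmod x \<times>\<times> Zmod (3 * x))
           (res3 2 x (3 * x) 1 0 0) (res3 2 x (3 * x) 1 1 1) (res3 2 x (3 * x) 1 3 2) k N) \<and>
        (odd x \<longrightarrow> attains (Zmod x \<times>\<times> Zmod (6 * x))
           (res2 x (6 * x) 0 (3 * int x)) (res2 x (6 * x) 1 (- 2))
           (res2 x (6 * x) (3 - int x) (3 * int x - 7)) k N) \<and>
        attains (Zmod x \<times>\<times> Zmod (6 * x))
           (res2 x (6 * x) 0 (3 * int x)) (res2 x (6 * x) 3 2) (res2 x (6 * x) 1 1) k N) \<and>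
      (\<forall>x::nat. x > 1 \<and> k = 3 * x \<longrightarrow>
        N = 6 * x^2 + 4 * x \<and>
        (even x \<longrightarrow> attains (Zmod 2 \<times>\<times> Zmod (N div 2))
           (res2 2 (N div 2) 1 0) (res2 2 (N div 2) 1 1)
           (res2 2 (N div 2) (- 3 * int x) (- 3 * int x)) k N) \<and>
        (odd x \<longrightarrow> attains (Zmod N)
           (res1 N (int N div 2)) (res1 N (int N div 2 + 1)) (res1 N (3 * int x ^ 2 - int x)) k N) \<and>
        attains (Zmod N)
           (res1 N (int N div 2)) (res1 N (2 * int x + 1)) (res1 N (int x)) k N) \<and>
      (\<forall>x::nat. x > 1 \<and> k = 3 * x + 1 \<longrightarrow>
        N = 6 * x^2 + 8 * x + 2 \<and>
        (even x \<longrightarrow>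
           attains (Zmod N)
             (res1 N (int N div 2)) (res1 N (int N div 2 + 1)) (res1 N (6 * int x ^ 2 + 5 * int x)) k N \<and>
           attains (Zmod N)
             (res1 N (int N div 2)) (res1 N (int N div 2 - 3 * int x - 2)) (res1 N (int N div 2 + 1)) k N) \<and>
        (odd x \<longrightarrow>
           attains (Zmod 2 \<times>\<times> Zmod (N div 2))
             (res2 2 (N div 2) 1 0) (res2 2 (N div 2) 1 1)
             (res2 2 (N div 2) (- 3 * int x - 2) (- 3 * int x - 2)) k N \<and>
           attains (Zmod N)
             (res1 N (int N div 2)) (res1 N (int N div 2 - 3 * int x - 2)) (res1 N 1) k N))"
\<comment> \<open>One witness serves all cases; each of them only evaluates it.\<close>
proof (rule exI[of _ "max_order k"], intro conjI allI impI)
  fix G :: "'a monoid" and S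
  assume "mixed_abelian_cayley_diam G S 1 0 2 k"
  then show "order G \<le> max_order k" by (rule order_le_max_order_of_diam)
next
  assume k: "k = 2"
  show N: "max_order k = 8" by (simp add: k max_order_def)
  show "attains (Zmod 8) 4 1 3 k (max_order k)" unfolding N unfolding k by (rule attains_8)
next
  assume k: "k = 3"
  show N: "max_order k = 12" by (simp add: k max_order_def)
  show "attains (Zmod 12) 6 1 4 k (max_order k)" unfolding N unfolding k by (rule attains_12)
next
  assume k: "k = 4"
  show N: "max_order k = 18" by (simp add: k max_order_def)
  show "attains (Zmod 18) 9 1 4 k (max_order k)" unfolding N unfolding k by (rule attains_18)
qed (simp_all only: max_order_3x_minus_1 max_order_3x max_order_3x_plus_1
  attains_3x_minus_1_even attains_3x_minus_1_odd attains_3x_minus_1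
  attains_3x_even attains_3x_odd attains_3x
  attains_3x_plus_1_even attains_3x_plus_1_even' attains_3x_plus_1_odd attains_3x_plus_1_odd'
  not_False_eq_True)

end
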